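(* Let $H$ be a finite connected graph (multiple edges allowed, no loops) with vertices $v_1,\dots,v_m$, and let $H_n=H_n(G_1,G_2,\dots,G_m)$ be the circulant foliation over $H$ with fibers $G_i=C_n(s_{i,1},s_{i,2},\dots,s_{i,k_i})$, $i=1,2,\dots,m$. Let $\tau(n)$ be the number of spanning trees in the graph $H_n$ and let $\tau(H)$ be the number of spanning trees in $H$. Let $Q(w)$ be the associated polynomial defined in the context and denote by $p$ the square-free part of $Q(-1)$. Then there exists an integer sequence $a(n)$ such that $1^0$ $\tau(n)=n\,\tau(H)\,a(n)^2$, if $n$ is odd; $2^0$ $\tau(n)=p\,n\,\tau(H)\,a(n)^2$, if $n$ is even.
   Context: The circulant graph $C_n(s_1,\dots,s_k)$, with integers $1\le s_1<\dots<s_k\le \frac n2$, has $n$ vertices indexed modulo $n$, with vertex $i$ adjacent to $i\pm s_1,\dots,i\pm s_k \pmod n$; if $n$ is even and $s_k=n/2$, the vertices $i$ and $i+s_k$ are joined by two edges. The empty circulant graph $C_n(\emptyset)$ consisting of $n$ isolated vertices is also allowed. Let $a_{i,j}$ be the number of edges between $v_i$ and $v_j$ in $H$ (so $a_{i,i}=0$), $A(H)=(a_{i,j})$ its adjacency matrix, and $d_i=\sum_j a_{i,j}$ the degree of $v_i$ in $H$. The circulant foliation $H_n=H_n(G_1,\dots,G_m)$ over $H$ with fibers $G_i=C_n(s_{i,1},\dots,s_{i,k_i})$ is the graph with vertex set $\{(k,v_i): k=1,\dots,n,\ i=1,\dots,m\}$ (first coordinate modulo $n$), where for each fixed $k$ the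 vertices $(k,v_i)$ and $(k,v_j)$ are joined by $a_{i,j}$ edges, and for each fixed $i$ the vertices $(k,v_i)$, $k=1,\dots,n$, form the graph $G_i$, in which $(k,v_i)$ is adjacent to $(k\pm s_{i,p},v_i)$, $p=1,\dots,k_i$. $Q(w)=\det\left(\mathrm{diag}(w_1,\dots,w_m)-A(H)\right)$ where $w_i=2k_i+d_i-\sum_{p=1}^{k_i}2\,T_{s_{i,p}}(w)$ and $T_k(w)=\cos(k\arccos w)$ is the Chebyshev polynomial of the first kind. Any positive integer $N$ can be uniquely represented in the form $N=p\,r^2$ with $p,r$ positive integers and $p$ square-free; $p$ is called the square-free part of $N$. *)

theory Defs
  imports
    Complex_Main
    "HOL-Computational_Algebra.Squarefree"
    "Jordan_Normal_Form.Determinant"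
begin

section \<open>Finite undirected multigraphs and their spanning trees\<close>

record ('v, 'e) multigraph =
  verts :: "'v set"
  edges :: "'e set"
  ends :: "'e \<Rightarrow> 'v set"

definition loopless_multigraph :: "('v, 'e) multigraph \<Rightarrow> bool" where
  "loopless_multigraph G \<longleftrightarrow> finite (verts G) \<and> finite (edges G) \<and>
     (\<forall>e\<in>edges G. ends G e \<subseteq> verts G \<and> card (ends G e) = 2)"

text \<open>A walk from \<open>u\<close> is the list of its steps \<open>(e, v)\<close>: traverse the edge \<open>e\<close> and arrive at \<open>v\<close>.\<close>

fun walk :: "('v, 'e) multigraph \<Rightarrow> 'v \<Rightarrow> ('e \<times> 'v) list \<Rightarrow> 'v \<Rightarrow> bool" where
  "walk G u [] w \<longleftrightarrow> u \<in> verts G \<and> u = w"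
| "walk G u ((e, v) # p) w \<longleftrightarrow>
     u \<in> verts G \<and> e \<in> edges G \<and> ends G e = {u, v} \<and> walk G v p w"

definition connected_multigraph :: "('v, 'e) multigraph \<Rightarrow> bool" where
  "connected_multigraph G \<longleftrightarrow> verts G \<noteq> {} \<and> (\<forall>u\<in>verts G. \<forall>v\<in>verts G. \<exists>p. walk G u p v)"

text \<open>Edges of a cycle are required to be distinct as well as vertices, so that a pair of parallel
  edges is a cycle but a single edge traversed back and forth is not.\<close>

definition is_cycle :: "('v, 'e) multigraph \<Rightarrow> 'v \<Rightarrow> ('e \<times> 'v) list \<Rightarrow> bool" where
  "is_cycle G u p \<longleftrightarrow> p \<noteq> [] \<and> walk G u p u \<and> distinct (map fst p) \<and> distinct (map snd p)"

definition is_tree :: "('v, 'e) multigraph \<Rightarrow> bool" where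
  "is_tree G \<longleftrightarrow> connected_multigraph G \<and> \<not> (\<exists>u p. is_cycle G u p)"

definition spanning_trees :: "('v, 'e) multigraph \<Rightarrow> 'e set set" where
  "spanning_trees G = {T. T \<subseteq> edges G \<and> is_tree (G\<lparr>edges := T\<rparr>)}"

definition num_spanning_trees :: "('v, 'e) multigraph \<Rightarrow> nat" where
  "num_spanning_trees G = card (spanning_trees G)"

definition edge_count :: "('v, 'e) multigraph \<Rightarrow> 'v \<Rightarrow> 'v \<Rightarrow> nat" where
  "edge_count G u v = card {e \<in> edges G. ends G e = {u, v}}"

definition degree_in :: "('v, 'e) multigraph \<Rightarrow> 'v \<Rightarrow> nat" where
  "degree_in G u = (\<Sum>v\<in>verts G. edge_count G u v)"


section \<open>Circulant graphs and circulant foliations\<close>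

text \<open>The list of jumps of a circulant graph is strictly increasing with \<open>1 \<le> x \<le> n / 2\<close> for each
  jump \<open>x\<close>.  The empty list is allowed.\<close>

definition jump_list :: "nat list \<Rightarrow> bool" where
  "jump_list xs \<longleftrightarrow> sorted_wrt (<) xs \<and> (\<forall>x\<in>set xs. 1 \<le> x)"

definition jumps_fit :: "nat \<Rightarrow> nat list \<Rightarrow> bool" where
  "jumps_fit n xs \<longleftrightarrow> (\<forall>x\<in>set xs. 2 * x \<le> n)"

text \<open>The edge \<open>(k, x)\<close> joins \<open>k\<close> to \<open>k + x\<close> modulo \<open>n\<close>.  If \<open>2 * x = n\<close>, then \<open>(k, x)\<close> and
  \<open>(k + x, x)\<close> are two parallel edges, as the convention for circulant graphs demands.\<close>

definition circulant :: "nat \<Rightarrow> nat list \<Rightarrow> (nat, nat \<times> nat) multigraph" where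
  "circulant n xs =
     \<lparr>verts = {..<n}, edges = {..<n} \<times> set xs, ends = (\<lambda>(k, x). {k, (k + x) mod n})\<rparr>"

text \<open>Edges \<open>Inl (k, e)\<close> are the edges of the copy of the base graph in layer \<open>k\<close>, and edges
  \<open>Inr (i, f)\<close> are the edges of the fiber over the vertex \<open>i\<close>.\<close>

definition foliation ::
  "nat \<Rightarrow> ('v, 'e) multigraph \<Rightarrow> ('v \<Rightarrow> (nat, 'f) multigraph)
     \<Rightarrow> (nat \<times> 'v, (nat \<times> 'e) + ('v \<times> 'f)) multigraph" where
  "foliation n H G =
     \<lparr>verts = {..<n} \<times> verts H,
      edges = Inl ` ({..<n} \<times> edges H) \<union> Inr ` (SIGMA i:verts H. edges (G i)),
      ends = (\<lambda>c. case c of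
          Inl (k, e) \<Rightarrow> (\<lambda>v. (k, v)) ` ends H e
        | Inr (i, f) \<Rightarrow> (\<lambda>k. (k, i)) ` ends (G i) f)\<rparr>"

definition circulant_foliation ::
  "nat \<Rightarrow> ('v, 'e) multigraph \<Rightarrow> ('v \<Rightarrow> nat list)
     \<Rightarrow> (nat \<times> 'v, (nat \<times> 'e) + ('v \<times> (nat \<times> nat))) multigraph" where
  "circulant_foliation n H s = foliation n H (\<lambda>i. circulant n (s i))"


section \<open>Chebyshev polynomials and the associated polynomial\<close>

text \<open>\<open>T\<^sub>k(w) = cos (k arccos w)\<close> on \<open>[-1, 1]\<close>.  The coefficients are integers; existence and
  uniqueness are proved below.\<close>

definition chebyshev_T :: "nat \<Rightarrow> int poly" where
  "chebyshev_T k =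
     (THE q. \<forall>w\<in>{-1..1::real}. poly (map_poly of_int q) w = cos (real k * arccos w))"

lemma chebyshev_T_exists:
  "\<exists>q::int poly. \<forall>w\<in>{-1..1::real}. poly (map_poly of_int q) w = cos (real k * arccos w)"
proof (induction k rule: less_induct)
  case (less k)
  consider "k = 0" | "k = 1" | j where "k = Suc (Suc j)"
    by (metis One_nat_def not0_implies_Suc)
  then show ?case
  proof cases
    case 1
    then show ?thesis by (intro exI[of _ 1]) simp
  next
    case 2
    then show ?thesis by (intro exI[of _ "[:0, 1:]"]) (simp add: map_poly_pCons)
  next
    case (3 j)
    from less[of j] 3 obtain q0 :: "int poly" where
      q0: "\<forall>w\<in>{-1..1::real}. poly (map_poly of_int q0) w = cos (real j * arccos w)" by auto
    from less[of "Suc j"] 3 obtain q1 :: "int poly" where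
      q1: "\<forall>w\<in>{-1..1::real}. poly (map_poly of_int q1) w = cos (real (Suc j) * arccos w)" by auto
    have sub: "map_poly of_int (q - r) = (map_poly of_int q - map_poly of_int r :: real poly)"
      for q r :: "int poly"
      by (intro poly_eqI) (simp add: coeff_map_poly)
    have "poly (map_poly of_int (pCons 0 (smult 2 q1) - q0)) w = cos (real k * arccos w)"
      if w: "w \<in> {-1..1::real}" for w
    proof -
      let ?t = "arccos w"
      have c: "cos ?t = w" using w by simp
      have "cos (real (Suc j) * ?t + ?t) + cos (real (Suc j) * ?t - ?t) =
          2 * w * cos (real (Suc j) * ?t)"
        unfolding cos_add cos_diff c by simp
      moreover have "real (Suc j) * ?t + ?t = real k * ?t" "real (Suc j) * ?t - ?t = real j * ?t"
        unfolding 3 by (simp_all add: algebra_simps)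
      ultimately have "cos (real k * ?t) = 2 * w * cos (real (Suc j) * ?t) - cos (real j * ?t)"
        by simp
      moreover have "poly (map_poly of_int (pCons 0 (smult 2 q1) - q0)) w =
          2 * w * poly (map_poly of_int q1) w - poly (map_poly of_int q0) w"
        using sub[of "pCons 0 (smult 2 q1)" q0] by (simp add: map_poly_pCons map_poly_smult)
      ultimately show ?thesis using q0 q1 w by simp
    qed
    then show ?thesis by blast
  qed
qed

lemma chebyshev_T_unique:
  fixes q r :: "int poly"
  assumes "\<forall>w\<in>{-1..1::real}. poly (map_poly of_int q) w = cos (real k * arccos w)"
    and "\<forall>w\<in>{-1..1::real}. poly (map_poly of_int r) w = cos (real k * arccos w)"
  shows "q = r"
proof -
  let ?d = "map_poly of_int q - map_poly of_int r :: real poly"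
  have "{-1..1::real} \<subseteq> {w. poly ?d w = 0}" using assms by auto
  moreover have "infinite {-1..1::real}" by simp
  ultimately have "infinite {w. poly ?d w = 0}" using finite_subset by blast
  then have "?d = 0" using poly_roots_finite by blast
  then have "coeff (map_poly of_int q :: real poly) n = coeff (map_poly of_int r) n" for n
    by simp
  then show ?thesis by (intro poly_eqI) (simp add: coeff_map_poly)
qed

lemma poly_chebyshev_T:
  assumes "w \<in> {-1..1::real}"
  shows "poly (map_poly of_int (chebyshev_T k)) w = cos (real k * arccos w)"
proof -
  have "\<exists>!q::int poly. \<forall>w\<in>{-1..1::real}. poly (map_poly of_int q) w = cos (real k * arccos w)"
    using chebyshev_T_exists chebyshev_T_unique by blast
  from theI'[OF this] show ?thesis
    using assms unfolding chebyshev_T_def by blast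
qed

text \<open>In the following the vertices of \<open>H\<close> are the numbers \<open>i < m\<close>.\<close>

definition adjacency_mat :: "nat \<Rightarrow> (nat, 'e) multigraph \<Rightarrow> nat mat" where
  "adjacency_mat m H = mat m m (\<lambda>(i, j). edge_count H i j)"

definition assoc_weight :: "(nat, 'e) multigraph \<Rightarrow> (nat \<Rightarrow> nat list) \<Rightarrow> nat \<Rightarrow> int poly" where
  "assoc_weight H s i =
     of_nat (2 * length (s i) + degree_in H i) - (\<Sum>x\<leftarrow>s i. 2 * chebyshev_T x)"

definition assoc_poly :: "nat \<Rightarrow> (nat, 'e) multigraph \<Rightarrow> (nat \<Rightarrow> nat list) \<Rightarrow> int poly" where
  "assoc_poly m H s = det (mat_diag m (assoc_weight H s) - map_mat of_nat (adjacency_mat m H))"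

text \<open>For positive integers \<open>squarefree_part\<close> is the usual square-free part.  The library sets
  \<open>squarefree_part 0 = 1\<close>.\<close>

lemma squarefree_part_eqI:
  fixes p r :: int
  assumes "p > 0" "r > 0" "squarefree p"
  shows "squarefree_part (p * r\<^sup>2) = p"
proof -
  have "square_part (p * r\<^sup>2) = r"
  proof (rule associated_eqI)
    have *: "x dvd square_part (p * r\<^sup>2) \<longleftrightarrow> x dvd r" for x
    proof -
      have "multiplicity q x \<le> multiplicity q r"
        if x: "x\<^sup>2 dvd p * r\<^sup>2" and q: "prime q" for q
      proof -
        have "x \<noteq> 0" using x assms by auto
        have "multiplicity q (x\<^sup>2) \<le> multiplicity q (p * r\<^sup>2)"
          using x assms by (intro dvd_imp_multiplicity_le) auto
        moreover have "multiplicity q p \<le> 1"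
          using assms q by (auto simp: squarefree_factorial_semiring'')
        moreover have "multiplicity q (x\<^sup>2) = 2 * multiplicity q x"
          using prime_imp_prime_elem[OF q] \<open>x \<noteq> 0\<close>
          by (simp add: prime_elem_multiplicity_power_distrib)
        moreover have "multiplicity q (p * r\<^sup>2) = multiplicity q p + 2 * multiplicity q r"
          using prime_imp_prime_elem[OF q] assms
          by (simp add: prime_elem_multiplicity_mult_distrib
              prime_elem_multiplicity_power_distrib)
        ultimately show ?thesis by linarith
      qed
      then have "x dvd r" if "x\<^sup>2 dvd p * r\<^sup>2"
        using that assms by (intro multiplicity_le_imp_dvd) auto
      then show ?thesis by (auto simp: dvd_square_part_iff)
    qed
    show "square_part (p * r\<^sup>2) dvd r"
      using *[of "square_part (p * r\<^sup>2)"] by simp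
    show "r dvd square_part (p * r\<^sup>2)"
      using *[of r] by simp
    show "normalize (square_part (p * r\<^sup>2)) = square_part (p * r\<^sup>2)"
      by (rule normalize_square_part)
    show "normalize r = r"
      using assms by simp
  qed
  then show ?thesis using assms by (simp add: squarefree_part_def)
qed

end

theory Submission
  imports Defs "Jordan_Normal_Form.Char_Poly"
begin

text \<open>
  By the matrix-tree theorem the number of spanning trees is read off from the Laplacian, in the
  form \<open>det (L + x) = x * N\<^sup>2 * \<tau>\<close>, where \<open>x\<close> is added to every one of the \<open>N * N\<close> entries
  (\<open>det_laplacian_add_constant\<close>).  The theorem itself, \<open>matrix_tree\<close>, holds because expanding the rows
  of the Laplacian chooses a parent edge for every vertex but the root, and a
  choice has determinant \<open>1\<close> or \<open>0\<close> according to whether it orients a spanning tree towards the root.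

  The Laplacian of a circulant foliation is block circulant, so the discrete Fourier transform splits
  it into one block for each \<open>n\<close>-th root of unity \<open>z\<close>: the Laplacian of \<open>H\<close> with
  \<open>2 - z\<^sup>x - z\<^sup>-\<^sup>x\<close> added on the diagonal for each jump \<open>x\<close>.  Its determinant is the value at
  \<open>t = z + z\<^sup>-\<^sup>1\<close> of an integer polynomial \<open>P\<close> (\<open>foliation_poly\<close>), with \<open>P (2 w) = Q w\<close> for the associated
  polynomial \<open>Q\<close>.  Comparing determinants gives \<open>n * \<tau> n = \<tau> H * (\<Prod>z. P (z + z\<^sup>-\<^sup>1))\<close>, where the product ranges
  over \<open>z \<noteq> 1\<close> (\<open>prod_unity_sums\<close>).

  At \<open>z = 1\<close> the block is the Laplacian of \<open>H\<close>, which is singular.  Hence \<open>P t = (2 - t) * F t\<close> with \<open>F\<close> again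
  integral.  The product of the factors \<open>2 - t\<close> is \<open>n\<^sup>2\<close>, so \<open>\<tau> n\<close> is \<open>n * \<tau> H\<close> times the
  product of the \<open>F (z + z\<^sup>-\<^sup>1)\<close>.  The roots \<open>z\<close> and \<open>z\<^sup>-\<^sup>1\<close> contribute the same factor, so the product is a square
  \<open>c\<^sup>2\<close>, times \<open>F (-2)\<close> for the root \<open>z = -1\<close> if \<open>n\<close> is even.  The number \<open>c\<close> is an integer,
  as it is the product of the values of an integer polynomial at all roots of a monic integer polynomial
  (\<open>half_product_integer\<close>).  Finally \<open>Q (-1) = P (-2) = 4 * F (-2)\<close>, so \<open>F (-2)\<close> is \<open>p\<close> times a square.
\<close>

section \<open>Walks\<close>

lemma walk_in_verts: "walk G u p w \<Longrightarrow> u \<in> verts G \<and> w \<in> verts G"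
  by (induction G u p w rule: walk.induct) auto

lemma walk_append: "walk G u (p @ q) w \<longleftrightarrow> (\<exists>v. walk G u p v \<and> walk G v q w)"
  by (induction G u p w rule: walk.induct) (auto dest: walk_in_verts)

lemma walk_reverse: "walk G u p w \<Longrightarrow> \<exists>q. walk G w q u"
proof (induction G u p w rule: walk.induct)
  case (2 G u e v p w)
  then obtain q where "walk G w q v" by auto
  moreover have "walk G v [(e, u)] u"
    using 2 by (auto dest: walk_in_verts)
  ultimately show ?case using walk_append[of G w q "[(e, u)]" u] by metis
next
  case (1 G u w)
  then show ?case by (intro exI[of _ "[]"]) auto
qed

lemma walk_mono: "walk (G\<lparr>edges := S\<rparr>) u p w \<Longrightarrow> S \<subseteq> T \<Longrightarrow> walk (G\<lparr>edges := T\<rparr>) u p w"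
  by (induction p arbitrary: u) auto

lemma walk_edges: "walk G u p w \<Longrightarrow> fst ` set p \<subseteq> edges G"
  by (induction G u p w rule: walk.induct) auto

lemma walk_ends_subset: "walk G u p w \<Longrightarrow> (e, x) \<in> set p \<Longrightarrow> ends G e \<subseteq> insert u (snd ` set p)"
  by (induction G u p w arbitrary: e x rule: walk.induct) fastforce+

lemma walk_last: "walk G u p w \<Longrightarrow> p \<noteq> [] \<Longrightarrow> snd (last p) = w"
  by (induction G u p w rule: walk.induct) auto

lemma walk_nth:
  "walk G u p w \<Longrightarrow> i < length p \<Longrightarrow>
    ends G (fst (p ! i)) = {if i = 0 then u else snd (p ! (i - 1)), snd (p ! i)}"
proof (induction G u p w arbitrary: i rule: walk.induct)
  case (2 G u e v p w)
  show ?case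
  proof (cases i)
    case (Suc j)
    then show ?thesis using 2 by (cases j) auto
  qed (use 2 in auto)
qed auto

lemma walk_simple:
  assumes "walk G u p w"
  shows "\<exists>q. walk G u q w \<and> distinct (u # map snd q)"
  using assms
proof (induction G u p w rule: walk.induct)
  case (2 G u e v p w)
  then obtain q where q: "walk G v q w" "distinct (v # map snd q)" by auto
  show ?case
  proof (cases "u \<in> set (v # map snd q)")
    case False
    then show ?thesis using q 2 by (intro exI[of _ "(e, v) # q"]) auto
  next
    case True
    show ?thesis
    proof (cases "u = v")
      case False
      then obtain e' where "(e', u) \<in> set q" using True by auto
      then obtain q1 q2 where "q = q1 @ (e', u) # q2" by (meson split_list)
      then show ?thesis using q by (intro exI[of _ q2]) (auto simp: walk_append)
    qed (use q in auto)
  qed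
next
  case (1 G u w)
  then show ?case by (intro exI[of _ "[]"]) auto
qed

text \<open>A repeated edge would lead back to one of its ends.\<close>

lemma simple_walk_distinct_edges:
  "walk G u p w \<Longrightarrow> distinct (u # map snd p) \<Longrightarrow> distinct (map fst p)"
proof (induction G u p w rule: walk.induct)
  case (2 G u e v p w)
  have "e \<notin> fst ` set p"
  proof
    assume "e \<in> fst ` set p"
    then obtain x where "(e, x) \<in> set p" by auto
    then have "ends G e \<subseteq> insert v (snd ` set p)" using walk_ends_subset 2 by fastforce
    then show False using 2 by auto
  qed
  then show ?case using 2 by auto
qed auto

text \<open>A tree is a maximal cycle-free set of edges: a further edge closes up with the path between
  its two ends.\<close>

lemma extra_edge_cycle:
  assumes "loopless_multigraph G" "T \<subseteq> edges G" "S \<subseteq> T" "connected_multigraph (G\<lparr>edges := S\<rparr>)"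
    and e: "e \<in> T" "e \<notin> S"
  shows "\<exists>u p. is_cycle (G\<lparr>edges := T\<rparr>) u p"
proof -
  have "card (ends G e) = 2" "ends G e \<subseteq> verts G"
    using assms unfolding loopless_multigraph_def by auto
  then obtain x y where xy: "ends G e = {x, y}" "x \<noteq> y" "x \<in> verts G" "y \<in> verts G"
    by (auto simp: card_2_iff)
  then obtain p where "walk (G\<lparr>edges := S\<rparr>) y p x"
    using assms(4) unfolding connected_multigraph_def by fastforce
  then obtain q where q: "walk (G\<lparr>edges := S\<rparr>) y q x" "distinct (y # map snd q)"
    using walk_simple by metis
  have "walk (G\<lparr>edges := T\<rparr>) x ((e, y) # q) x"
    using walk_mono[OF q(1) assms(3)] xy e by simp
  moreover have "distinct (map fst ((e, y) # q))"
    using simple_walk_distinct_edges[OF q] walk_edges[OF q(1)] e by auto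
  ultimately have "is_cycle (G\<lparr>edges := T\<rparr>) x ((e, y) # q)"
    using q(2) unfolding is_cycle_def by simp
  then show ?thesis by blast
qed


section \<open>Spanning trees as parent functions\<close>

definition other_end :: "('v, 'e) multigraph \<Rightarrow> 'e \<Rightarrow> 'v \<Rightarrow> 'v" where
  "other_end G e u = (THE w. ends G e = {u, w})"

lemma ends_other_end:
  assumes "loopless_multigraph G" "e \<in> edges G" "u \<in> ends G e"
  shows "ends G e = {u, other_end G e u}" "other_end G e u \<noteq> u" "other_end G e u \<in> verts G"
proof -
  have *: "card (ends G e) = 2" "ends G e \<subseteq> verts G"
    using assms unfolding loopless_multigraph_def by auto
  then obtain w where w: "ends G e = {u, w}" "w \<noteq> u"
    using assms(3) unfolding card_2_iff by (metis insertE insert_commute singletonD)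
  then have "other_end G e u = w"
    unfolding other_end_def by (intro the_equality) (auto simp: doubleton_eq_iff)
  with w * show "ends G e = {u, other_end G e u}" "other_end G e u \<noteq> u" "other_end G e u \<in> verts G"
    by auto
qed

lemma other_end_eqI: "ends G e = {u, w} \<Longrightarrow> other_end G e u = w"
  unfolding other_end_def by (intro the_equality) (auto simp: doubleton_eq_iff)

definition incident :: "('v, 'e) multigraph \<Rightarrow> 'v \<Rightarrow> 'e set" where
  "incident G u = {e \<in> edges G. u \<in> ends G e}"

text \<open>The rank \<open>d\<close> is a certificate that following parents never runs into a directed cycle.\<close>

definition ranked_by :: "('v, 'e) multigraph \<Rightarrow> 'v \<Rightarrow> ('v \<Rightarrow> 'e) \<Rightarrow> ('v \<Rightarrow> nat) \<Rightarrow> bool" where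
  "ranked_by G r f d \<longleftrightarrow> (\<forall>u\<in>verts G - {r}. d (other_end G (f u) u) < d u)"

definition parent_functions :: "('v, 'e) multigraph \<Rightarrow> 'v \<Rightarrow> ('v \<Rightarrow> 'e) set" where
  "parent_functions G r =
     {f \<in> PiE (verts G - {r}) (incident G). \<exists>d. ranked_by G r f d}"

context
  fixes G :: "('v, 'e) multigraph" and r :: 'v
  assumes G: "loopless_multigraph G" and r: "r \<in> verts G"
begin

lemma parent_edge:
  assumes "f \<in> PiE (verts G - {r}) (incident G)" "u \<in> verts G" "u \<noteq> r"
  shows "f u \<in> edges G" "u \<in> ends G (f u)" "ends G (f u) = {u, other_end G (f u) u}"
    "other_end G (f u) u \<noteq> u" "other_end G (f u) u \<in> verts G"
proof -
  show *: "f u \<in> edges G" "u \<in> ends G (f u)"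
    using assms unfolding incident_def by (auto simp: PiE_def Pi_def)
  show "ends G (f u) = {u, other_end G (f u) u}"
    "other_end G (f u) u \<noteq> u" "other_end G (f u) u \<in> verts G"
    using ends_other_end[OF G *] by auto
qed

text \<open>Among the two ends of a parent edge, the one of higher rank is the child.\<close>

lemma parent_edge_child:
  assumes "f \<in> PiE (verts G - {r}) (incident G)" "ranked_by G r f d"
    and "e \<in> f ` (verts G - {r})" "ends G e = {x, y}" "d y \<le> d x"
  shows "x \<noteq> r \<and> e = f x"
proof -
  obtain w where w: "w \<in> verts G" "w \<noteq> r" "e = f w" using assms by auto
  have "w \<in> {x, y}" using parent_edge[OF assms(1) w(1,2)] w assms by auto
  moreover have "w = x" if "w = y"
  proof -
    have "other_end G (f w) w = x" using that assms w by (intro other_end_eqI) auto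
    then have "d x < d y" using assms(2) w that unfolding ranked_by_def by auto
    then show ?thesis using assms by simp
  qed
  ultimately show ?thesis using w by auto
qed

lemma parent_image_connected:
  assumes f: "f \<in> PiE (verts G - {r}) (incident G)" "ranked_by G r f d"
  shows "connected_multigraph (G\<lparr>edges := f ` (verts G - {r})\<rparr>)"
proof -
  let ?T = "G\<lparr>edges := f ` (verts G - {r})\<rparr>"
  have to_root: "\<exists>p. walk ?T u p r" if "u \<in> verts G" for u
    using that
  proof (induction "d u" arbitrary: u rule: less_induct)
    case less
    show ?case
    proof (cases "u = r")
      case True
      then show ?thesis using less by (intro exI[of _ "[]"]) auto
    next
      case False
      let ?w = "other_end G (f u) u"
      have "d ?w < d u" using f(2) False less unfolding ranked_by_def by auto
      then obtain p where "walk ?T ?w p r"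
        using less parent_edge[OF f(1) less(2) False] by blast
      then have "walk ?T u ((f u, ?w) # p) r"
        using less(2) False parent_edge(3)[OF f(1) less(2) False] by auto
      then show ?thesis by blast
    qed
  qed
  have "\<exists>p. walk ?T u p w" if uw: "u \<in> verts G" "w \<in> verts G" for u w
  proof -
    obtain p q where "walk ?T u p r" "walk ?T w q r" using to_root uw by metis
    then obtain q' where "walk ?T r q' w" using walk_reverse by metis
    then show ?thesis using \<open>walk ?T u p r\<close> walk_append[of ?T u p q' w] by metis
  qed
  then show ?thesis
    using r unfolding connected_multigraph_def by auto
qed

text \<open>On a cycle, both cycle edges at a vertex of maximal rank would be its parent edge.\<close>

lemma parent_image_acyclic:
  assumes f: "f \<in> PiE (verts G - {r}) (incident G)" "ranked_by G r f d"
  shows "\<not> is_cycle (G\<lparr>edges := f ` (verts G - {r})\<rparr>) u p"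
proof
  let ?T = "G\<lparr>edges := f ` (verts G - {r})\<rparr>"
  assume "is_cycle ?T u p"
  then have p: "p \<noteq> []" "walk ?T u p u" "distinct (map fst p)" unfolding is_cycle_def by auto
  let ?prev = "\<lambda>i. if i = 0 then u else snd (p ! (i - 1))"
  have edge: "ends G (fst (p ! i)) = {?prev i, snd (p ! i)}" "fst (p ! i) \<in> f ` (verts G - {r})"
    if "i < length p" for i
    using walk_nth[OF p(2) that] walk_edges[OF p(2)] that by auto
  have last: "snd (p ! (length p - 1)) = u"
    using walk_last[OF p(2,1)] p(1) by (simp add: last_conv_nth)
  obtain i where i: "i < length p" and max: "\<And>j. j < length p \<Longrightarrow> d (snd (p ! j)) \<le> d (snd (p ! i))"
  proof -
    let ?A = "(\<lambda>j. d (snd (p ! j))) ` {..<length p}"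
    have "Max ?A \<in> ?A" using p(1) by (intro Max_in) auto
    then obtain i where "i < length p" "Max ?A = d (snd (p ! i))" by auto
    then show ?thesis using that[of i] by (metis Max_ge finite_imageI finite_lessThan imageI lessThan_iff)
  qed
  have prev_le: "d (?prev j) \<le> d (snd (p ! i))" if "j < length p" for j
    using max[of "j - 1"] max[of "length p - 1"] last that p(1) by auto
  let ?x = "snd (p ! i)"
  \<comment> \<open>\<open>j\<close> is the position after \<open>i\<close> on the cycle, so the steps \<open>i\<close> and \<open>j\<close> enter and leave \<open>?x\<close>.\<close>
  obtain j where j: "j < length p" and prev_j: "?prev j = ?x"
  proof (cases "Suc i < length p")
    case True
    then show ?thesis using that[of "Suc i"] by simp
  next
    case False
    then have "i = length p - 1" using i by linarith
    then show ?thesis using that[of 0] last p(1) by simp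
  qed
  have "fst (p ! i) = f ?x"
    using parent_edge_child[OF f edge(2)[OF i], of ?x "?prev i"] edge(1)[OF i] prev_le[OF i] by auto
  moreover have "fst (p ! j) = f ?x"
    using parent_edge_child[OF f edge(2)[OF j], of ?x "snd (p ! j)"] edge(1)[OF j] prev_j max[OF j] by auto
  ultimately have "j = i"
    using nth_eq_iff_index_eq[OF p(3), of j i] i j by simp
  then have "?prev i = ?x" using prev_j by metis
  then have "card (ends G (fst (p ! i))) = 1" using edge(1)[OF i] by simp
  moreover have "fst (p ! i) \<in> edges G"
    using edge(2)[OF i] parent_edge(1)[OF f(1)] by (metis DiffE imageE insertI1)
  ultimately show False using G unfolding loopless_multigraph_def by auto
qed

lemma parent_image_spanning_tree:
  assumes "f \<in> parent_functions G r"
  shows "f ` (verts G - {r}) \<in> spanning_trees G"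
proof -
  obtain d where f: "f \<in> PiE (verts G - {r}) (incident G)" "ranked_by G r f d"
    using assms unfolding parent_functions_def by auto
  have "f ` (verts G - {r}) \<subseteq> edges G" using parent_edge(1)[OF f(1)] by auto
  then show ?thesis
    using parent_image_connected[OF f] parent_image_acyclic[OF f]
    unfolding spanning_trees_def is_tree_def by simp
qed

text \<open>Conversely, a spanning tree is oriented towards \<open>r\<close> by the distance to \<open>r\<close>; the parent edges
  already span, so by \<open>extra_edge_cycle\<close> they exhaust the tree.\<close>

lemma spanning_tree_parent_image:
  assumes "T \<in> spanning_trees G"
  shows "\<exists>f\<in>parent_functions G r. T = f ` (verts G - {r})"
proof -
  let ?T = "G\<lparr>edges := T\<rparr>"
  have T: "T \<subseteq> edges G" "connected_multigraph ?T" "\<not> (\<exists>u p. is_cycle ?T u p)"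
    using assms unfolding spanning_trees_def is_tree_def by auto
  define d where "d u = (LEAST k. \<exists>p. walk ?T u p r \<and> length p = k)" for u
  have d_le: "d u \<le> length p" if "walk ?T u p r" for u p
    unfolding d_def using that by (intro Least_le) auto
  have d_ex: "\<exists>p. walk ?T u p r \<and> length p = d u" if u: "u \<in> verts G" for u
  proof -
    have "\<exists>p. walk ?T u p r" using T(2) u r unfolding connected_multigraph_def by simp
    then have "\<exists>k p. walk ?T u p r \<and> length p = k" by simp
    from LeastI_ex[OF this] show ?thesis unfolding d_def .
  qed
  have "\<exists>e. e \<in> T \<and> u \<in> ends G e \<and> d (other_end G e u) < d u" if u: "u \<in> verts G - {r}" for u
  proof -
    obtain p where p: "walk ?T u p r" "length p = d u" using d_ex u by (meson DiffD1)
    then obtain e v q where q: "p = (e, v) # q" using u by (cases p) auto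
    then have e: "walk ?T v q r" "e \<in> T" "ends G e = {u, v}" using p by auto
    moreover have "d v < d u" using d_le[OF e(1)] p(2) q by simp
    ultimately show ?thesis using other_end_eqI[OF e(3)] by (intro exI[of _ e]) simp
  qed
  then obtain g where g: "\<And>u. u \<in> verts G - {r} \<Longrightarrow>
      g u \<in> T \<and> u \<in> ends G (g u) \<and> d (other_end G (g u) u) < d u" by metis
  define f where "f = restrict g (verts G - {r})"
  have f: "f \<in> PiE (verts G - {r}) (incident G)" "ranked_by G r f d"
    using g T(1) unfolding f_def ranked_by_def incident_def by auto
  have "f ` (verts G - {r}) \<subseteq> T" using g unfolding f_def by auto
  moreover have "T \<subseteq> f ` (verts G - {r})"
    using extra_edge_cycle[OF G T(1) calculation parent_image_connected[OF f]] T(3) by blast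
  ultimately show ?thesis using f unfolding parent_functions_def by blast
qed

text \<open>A tree edge at \<open>u\<close> is the parent edge of one of its two ends.  By induction along the parents
  given by \<open>f\<close>, the edge \<open>f u\<close> cannot be the \<open>g\<close>-parent edge of the other end.\<close>

lemma inj_on_parent_image:
  "inj_on (\<lambda>f. f ` (verts G - {r})) (parent_functions G r)"
proof (rule inj_onI)
  fix f g
  assume "f \<in> parent_functions G r" "g \<in> parent_functions G r"
    and eq: "f ` (verts G - {r}) = g ` (verts G - {r})"
  then obtain d where f: "f \<in> PiE (verts G - {r}) (incident G)" "ranked_by G r f d"
    and g: "g \<in> PiE (verts G - {r}) (incident G)"
    unfolding parent_functions_def by auto
  have "f u = g u" if "u \<in> verts G" "u \<noteq> r" for u
    using that
  proof (induction "d u" arbitrary: u rule: less_induct)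
    case less
    define w where "w = other_end G (f u) u"
    note fu = parent_edge[OF f(1) less(2,3), folded w_def]
    have dw: "d w < d u" using f(2) less(2,3) unfolding ranked_by_def w_def by simp
    have "f u \<in> g ` (verts G - {r})" using less(2,3) unfolding eq[symmetric] by auto
    then obtain x where x: "x \<in> verts G" "x \<noteq> r" "f u = g x" by auto
    have "x \<in> ends G (f u)" using parent_edge(2)[OF g x(1,2)] x(3) by simp
    then consider "x = u" | "x = w" using fu(3) by auto
    then show ?case
    proof cases
      case 2
      have "f u = f w" using less(1)[OF dw] x 2 by metis
      then have "other_end G (f w) w = u" using fu(3) by (intro other_end_eqI) auto
      then have "d u < d w" using f(2) x(1,2) 2 unfolding ranked_by_def by auto
      then show ?thesis using dw by simp
    qed (use x in simp)
  qed
  then show "f = g" using f(1) g by (intro PiE_ext) auto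
qed

lemma num_spanning_trees_eq_card_parent_functions:
  "num_spanning_trees G = card (parent_functions G r)"
proof -
  have "spanning_trees G = (\<lambda>f. f ` (verts G - {r})) ` parent_functions G r"
    using parent_image_spanning_tree spanning_tree_parent_image by blast
  then show ?thesis
    unfolding num_spanning_trees_def by (simp add: card_image inj_on_parent_image)
qed

end

section \<open>The matrix-tree theorem\<close>

text \<open>An edge at \<open>u\<close> contributes \<open>2 - 1\<close> on the diagonal and \<open>0 - 1\<close> at its other end.  In this form
  the other end need not be named.\<close>

definition laplacian :: "('v, 'e) multigraph \<Rightarrow> 'v \<Rightarrow> 'v \<Rightarrow> 'a::comm_ring_1" where
  "laplacian G u w = (\<Sum>e\<in>incident G u. 2 * of_bool (u = w) - of_bool (w \<in> ends G e))"

lemma finite_incident: "loopless_multigraph G \<Longrightarrow> finite (incident G u)"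
  unfolding loopless_multigraph_def incident_def by simp

lemma det_expand_rows:
  fixes B :: "'v \<Rightarrow> 'e \<Rightarrow> 'v \<Rightarrow> 'a::comm_ring_1"
  assumes v: "bij_betw v {..<N} V" and S: "\<And>u. u \<in> V \<Longrightarrow> finite (S u)"
  shows "det (mat N N (\<lambda>(i, j). \<Sum>e\<in>S (v i). B (v i) e (v j))) =
    (\<Sum>f\<in>PiE V S. det (mat N N (\<lambda>(i, j). B (v i) (f (v i)) (v j))))"
proof -
  let ?P = "{p. p permutes {0..<N}}"
  have v': "bij_betw v {0..<N} V" using v by (simp add: atLeast0LessThan)
  have "finite V" using v bij_betw_finite by blast
  have prod: "(\<Prod>i = 0..<N. \<Sum>e\<in>S (v i). B (v i) e (v (p i))) =
      (\<Sum>f\<in>PiE V S. \<Prod>i = 0..<N. B (v i) (f (v i)) (v (p i)))" for p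
  proof -
    let ?q = "\<lambda>u. v (p (inv_into {0..<N} v u))"
    have q: "?q (v i) = v (p i)" if "i \<in> {0..<N}" for i
      using bij_betw_inv_into_left[OF v' that] by simp
    have "(\<Prod>i = 0..<N. \<Sum>e\<in>S (v i). B (v i) e (v (p i))) = (\<Prod>u\<in>V. \<Sum>e\<in>S u. B u e (?q u))"
      by (subst prod.reindex_bij_betw[OF v', symmetric]) (intro prod.cong refl, simp only: q)
    also have "\<dots> = (\<Sum>f\<in>PiE V S. \<Prod>u\<in>V. B u (f u) (?q u))"
      using \<open>finite V\<close> S by (rule prod_sum_PiE)
    also have "\<dots> = (\<Sum>f\<in>PiE V S. \<Prod>i = 0..<N. B (v i) (f (v i)) (v (p i)))"
    proof (intro sum.cong refl)
      fix f
      show "(\<Prod>u\<in>V. B u (f u) (?q u)) = (\<Prod>i = 0..<N. B (v i) (f (v i)) (v (p i)))"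
        by (subst prod.reindex_bij_betw[OF v', symmetric]) (intro prod.cong refl, simp only: q)
    qed
    finally show ?thesis .
  qed
  have det_entries: "det (mat N N (\<lambda>(i, j). C i j)) =
      (\<Sum>p\<in>?P. signof p * (\<Prod>i = 0..<N. C i (p i)))" for C :: "nat \<Rightarrow> nat \<Rightarrow> 'a"
    by (subst det_def'[of _ N])
      (auto intro!: sum.cong prod.cong arg_cong2[where f = "(*)"] dest: permutes_in_image)
  have "det (mat N N (\<lambda>(i, j). \<Sum>e\<in>S (v i). B (v i) e (v j))) =
      (\<Sum>p\<in>?P. \<Sum>f\<in>PiE V S. signof p * (\<Prod>i = 0..<N. B (v i) (f (v i)) (v (p i))))"
    unfolding det_entries prod by (simp add: sum_distrib_left)
  also have "\<dots> = (\<Sum>f\<in>PiE V S. \<Sum>p\<in>?P. signof p * (\<Prod>i = 0..<N. B (v i) (f (v i)) (v (p i))))"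
    by (rule sum.swap)
  finally show ?thesis unfolding det_entries .
qed

text \<open>With a rank, only the identity permutation contributes: a permutation cannot lower
  the rank somewhere without raising it elsewhere.  Without a rank, the
  vertices from which the parents never lead to \<open>r\<close> give a vector in the kernel.\<close>

lemma det_parent_matrix:
  fixes par :: "'v \<Rightarrow> 'v"
  assumes v: "bij_betw v {..<N} V" and r: "r \<in> V" and par: "\<And>u. u \<in> V - {r} \<Longrightarrow> par u \<in> V"
  shows "det (mat N N (\<lambda>(i, j). if v i = r then of_bool (v j = r)
        else of_bool (v j = v i) - of_bool (v j = par (v i)))) =
      (of_bool (\<exists>d::'v \<Rightarrow> nat. \<forall>u\<in>V - {r}. d (par u) < d u) :: 'a::idom)"
    (is "det ?A = _")
proof (cases "\<exists>d::'v \<Rightarrow> nat. \<forall>u\<in>V - {r}. d (par u) < d u")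
  case True
  then obtain d :: "'v \<Rightarrow> nat" where d: "\<And>u. u \<in> V - {r} \<Longrightarrow> d (par u) < d u" by auto
  let ?P = "{p. p permutes {0..<N}}"
  have vV: "v i \<in> V" if "i < N" for i using v that by (auto simp: bij_betw_def)
  have inj: "v i = v j \<longleftrightarrow> i = j" if "i < N" "j < N" for i j
    using v that by (auto simp: bij_betw_def inj_on_def)
  have diag: "?A $$ (i, i) = 1" if "i < N" for i
    using that d[of "v i"] vV[OF that] by (cases "v i = r") auto
  have zero: "(\<Prod>i = 0..<N. ?A $$ (i, p i)) = 0" if p: "p permutes {0..<N}" "p \<noteq> id" for p
  proof (rule ccontr)
    assume nz: "(\<Prod>i = 0..<N. ?A $$ (i, p i)) \<noteq> 0"
    have pN: "p i < N" if "i < N" for i using permutes_in_image[OF p(1), of i] that by simp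
    have step: "p i = i \<or> d (v (p i)) < d (v i)" if "i < N" for i
    proof -
      have "?A $$ (i, p i) \<noteq> 0" using nz that by auto
      then have "if v i = r then v (p i) = r else v (p i) = v i \<or> v (p i) = par (v i)"
        using that pN[OF that] by (auto split: if_splits)
      then show ?thesis
        using inj[OF pN[OF that] that] d[of "v i"] vV[OF that] by (auto split: if_splits)
    qed
    \<comment> \<open>A nonzero factor sends \<open>i\<close> to itself or to its parent, so the total rank would drop.\<close>
    have "\<exists>i<N. p i \<noteq> i"
      using p unfolding permutes_def by (metis atLeastLessThan_iff eq_id_iff zero_le)
    then have "(\<Sum>i = 0..<N. d (v (p i))) < (\<Sum>i = 0..<N. d (v i))"
      using step by (intro sum_strict_mono_ex1) (auto intro: less_imp_le, force+)
    then show False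
      using sum.permute[OF p(1), of "\<lambda>i. d (v i)"] by (simp add: comp_def)
  qed
  have "det ?A = (\<Sum>p\<in>?P. signof p * (\<Prod>i = 0..<N. ?A $$ (i, p i)))"
    by (rule det_def') simp
  also have "\<dots> = (\<Sum>p\<in>{id}. signof p * (\<Prod>i = 0..<N. ?A $$ (i, p i)))"
  proof (rule sum.mono_neutral_right)
    show "\<forall>p\<in>?P - {id}. signof p * (\<Prod>i = 0..<N. ?A $$ (i, p i)) = 0"
    proof
      fix p assume "p \<in> ?P - {id}"
      then have "(\<Prod>i = 0..<N. ?A $$ (i, p i)) = 0" by (intro zero) simp_all
      then show "signof p * (\<Prod>i = 0..<N. ?A $$ (i, p i)) = 0" by (simp only: mult_zero_right)
    qed
    show "finite ?P" by (simp add: finite_permutations)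
    show "{id} \<subseteq> ?P" by (simp add: permutes_id)
  qed
  also have "\<dots> = 1" by (simp add: diag del: index_mat)
  finally show ?thesis using True by auto
next
  case False
  define par' where "par' u = (if u = r then r else par u)" for u
  define C where "C = {u \<in> V. \<forall>k. (par' ^^ k) u \<noteq> r}"
  have C_step: "par u \<in> C \<longleftrightarrow> u \<in> C" if "u \<in> V" "u \<noteq> r" for u
  proof -
    have *: "(par' ^^ Suc k) u = (par' ^^ k) (par u)" for k
      using that by (simp add: funpow_swap1 par'_def)
    have "(\<forall>k. (par' ^^ k) u \<noteq> r) \<longleftrightarrow> (\<forall>k. (par' ^^ k) (par u) \<noteq> r)"
      using that(2) unfolding *[symmetric] by (metis funpow_0 not0_implies_Suc)
    then show ?thesis using that par[of u] unfolding C_def by auto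
  qed
  have r_notin: "r \<notin> C" unfolding C_def by (auto intro: exI[of _ 0])
  have "C \<noteq> {}"
  proof
    assume "C = {}"
    then have ex: "\<exists>k. (par' ^^ k) u = r" if "u \<in> V" for u using that unfolding C_def by auto
    define d where "d u = (LEAST k. (par' ^^ k) u = r)" for u
    have "d (par u) < d u" if u: "u \<in> V - {r}" for u
    proof -
      have du: "(par' ^^ d u) u = r"
        unfolding d_def by (rule LeastI_ex) (rule ex, use u in simp)
      then obtain k where k: "d u = Suc k" using u by (cases "d u") auto
      then have "(par' ^^ Suc k) u = r" using du by simp
      then have "(par' ^^ k) (par u) = r"
        using u unfolding funpow_Suc_right by (simp add: par'_def)
      then have "d (par u) \<le> k" unfolding d_def by (rule Least_le)
      then show ?thesis using k by simp
    qed
    then show False using False by blast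
  qed
  then obtain u where u: "u \<in> C" by auto
  then obtain i where i: "i < N" "v i = u"
    using v unfolding C_def bij_betw_def by auto
  let ?x = "vec N (\<lambda>j. of_bool (v j \<in> C)) :: 'a vec"
  have delta: "(\<Sum>j = 0..<N. of_bool (v j = w) * of_bool (v j \<in> C)) = (of_bool (w \<in> C) :: 'a)"
    if "w \<in> V" for w
  proof -
    have "(\<Sum>j = 0..<N. of_bool (v j = w) * of_bool (v j \<in> C)) =
        (\<Sum>u\<in>V. of_bool (u = w) * of_bool (u \<in> C) :: 'a)"
      using v by (intro sum.reindex_bij_betw) (simp add: atLeast0LessThan)
    also have "\<dots> = (\<Sum>u\<in>V. if u = w then of_bool (w \<in> C) else 0)"
      by (intro sum.cong) auto
    also have "\<dots> = of_bool (w \<in> C)"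
      using that bij_betw_finite[OF v] by simp
    finally show ?thesis .
  qed
  have "?A *\<^sub>v ?x = 0\<^sub>v N"
  proof (rule eq_vecI)
    fix i assume "i < dim_vec (0\<^sub>v N :: 'a vec)"
    then have i: "i < N" by simp
    then have vi: "v i \<in> V" using v by (auto simp: bij_betw_def)
    have "(?A *\<^sub>v ?x) $ i = (\<Sum>j = 0..<N. ?A $$ (i, j) * of_bool (v j \<in> C))"
      using i by (simp add: scalar_prod_def)
    also have "\<dots> = 0"
    proof (cases "v i = r")
      case True
      then have "(\<Sum>j = 0..<N. ?A $$ (i, j) * of_bool (v j \<in> C)) =
          (\<Sum>j = 0..<N. of_bool (v j = r) * of_bool (v j \<in> C) :: 'a)"
        using i by (intro sum.cong) auto
      then show ?thesis using delta[OF r] r_notin by simp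
    next
      case False
      then have "(\<Sum>j = 0..<N. ?A $$ (i, j) * of_bool (v j \<in> C)) =
          (\<Sum>j = 0..<N. of_bool (v j = v i) * of_bool (v j \<in> C) -
             of_bool (v j = par (v i)) * of_bool (v j \<in> C) :: 'a)"
        using i by (intro sum.cong) (auto simp: algebra_simps)
      then show ?thesis
        using delta[OF vi] delta[OF par, of "v i"] vi False C_step[of "v i"]
        by (simp add: sum_subtractf)
    qed
    finally show "(?A *\<^sub>v ?x) $ i = (0\<^sub>v N :: 'a vec) $ i" using i by simp
  qed simp
  moreover have "?x \<noteq> 0\<^sub>v N"
  proof
    assume "?x = 0\<^sub>v N"
    then have "?x $ i = (0\<^sub>v N :: 'a vec) $ i" by simp
    then show False using i u by simp
  qed
  ultimately have "det ?A = 0"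
    by (subst det_0_iff_vec_prod_zero[of _ N]) (auto intro!: exI[of _ ?x])
  then show ?thesis using False by auto
qed

text \<open>Each row other than that of \<open>r\<close> is a sum over the edges at its vertex.  Expanding the
  determinant along these sums amounts to choosing a parent edge for every vertex, and the choices
  that survive are the parent functions of the spanning trees.\<close>

theorem matrix_tree:
  fixes G :: "('v, 'e) multigraph"
  assumes G: "loopless_multigraph G" and v: "bij_betw v {..<N} (verts G)" and r: "r \<in> verts G"
  shows "det (mat N N (\<lambda>(i, j). if v i = r then of_bool (v j = r) else laplacian G (v i) (v j))) =
    (of_nat (num_spanning_trees G) :: 'a::idom)"
proof -
  \<comment> \<open>The row of \<open>r\<close> is a sum with the single index \<open>undefined\<close>, which is the value that an extensional
    function on the other vertices takes at \<open>r\<close> anyway.\<close>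
  let ?S = "\<lambda>u. if u = r then {undefined} else incident G u"
  let ?B = "\<lambda>u e w. if u = r then of_bool (w = r)
      else of_bool (w = u) - of_bool (w = other_end G e u) :: 'a"
  let ?F = "PiE (verts G - {r}) (incident G)"
  have row: "laplacian G u w = (\<Sum>e\<in>incident G u. of_bool (w = u) - of_bool (w = other_end G e u) :: 'a)"
    for u w
    unfolding laplacian_def
  proof (intro sum.cong refl)
    fix e assume "e \<in> incident G u"
    then have "ends G e = {u, other_end G e u}" "other_end G e u \<noteq> u"
      using ends_other_end[OF G] unfolding incident_def by auto
    then show "2 * of_bool (u = w) - of_bool (w \<in> ends G e) =
        (of_bool (w = u) - of_bool (w = other_end G e u) :: 'a)"
      by (cases "w = u"; cases "w = other_end G e u") simp_all
  qed
  have F: "PiE (verts G) ?S = ?F"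
  proof (rule Set.set_eqI, rule iffI)
    fix f assume f: "f \<in> PiE (verts G) ?S"
    then have "f r = undefined" using r PiE_mem[OF f, of r] by simp
    then show "f \<in> ?F" using f by (auto simp: PiE_def Pi_def extensional_def split: if_splits)
  next
    fix f assume "f \<in> ?F"
    then show "f \<in> PiE (verts G) ?S" by (auto simp: PiE_def Pi_def extensional_def)
  qed
  have "det (mat N N (\<lambda>(i, j). if v i = r then of_bool (v j = r) else laplacian G (v i) (v j))) =
      det (mat N N (\<lambda>(i, j). \<Sum>e\<in>?S (v i). ?B (v i) e (v j)))"
    by (intro arg_cong[where f = det] cong_mat) (auto simp: row)
  also have "\<dots> = (\<Sum>f\<in>PiE (verts G) ?S. det (mat N N (\<lambda>(i, j). ?B (v i) (f (v i)) (v j))))"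
    using v by (rule det_expand_rows) (auto simp: finite_incident[OF G])
  also have "\<dots> = (\<Sum>f\<in>?F. of_bool (\<exists>d. ranked_by G r f d))"
    unfolding F
  proof (intro sum.cong refl)
    fix f assume f: "f \<in> ?F"
    have par: "other_end G (f u) u \<in> verts G" if "u \<in> verts G - {r}" for u
      using parent_edge(5)[OF G r f, of u] that by simp
    show "det (mat N N (\<lambda>(i, j). ?B (v i) (f (v i)) (v j))) =
        of_bool (\<exists>d. ranked_by G r f d)"
      unfolding ranked_by_def
      using det_parent_matrix[OF v r, of "\<lambda>u. other_end G (f u) u", where 'a = 'a, OF par] by simp
  qed
  also have "\<dots> = of_nat (card (parent_functions G r))"
  proof -
    have "finite ?F"
      using G by (intro finite_PiE finite_incident) (auto simp: loopless_multigraph_def)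
    then show ?thesis unfolding parent_functions_def by (simp add: Int_def)
  qed
  finally show ?thesis
    using num_spanning_trees_eq_card_parent_functions[OF G r] by simp
qed

text \<open>Adding all rows to the first one produces the constant row \<open>x * N\<close>, which clears the
  \<open>x\<close> from the other rows; adding all columns to the first one then isolates the entry \<open>N\<close> in the
  corner.\<close>

lemma det_add_constant:
  fixes A :: "nat \<Rightarrow> nat \<Rightarrow> 'a::idom"
  assumes N: "N > 0" and row: "\<And>i. i < N \<Longrightarrow> (\<Sum>j<N. A i j) = 0"
    and col: "\<And>j. j < N \<Longrightarrow> (\<Sum>i<N. A i j) = 0"
  shows "det (mat N N (\<lambda>(i, j). A i j + x)) =
    x * of_nat N ^ 2 * det (mat N N (\<lambda>(i, j). if i = 0 then of_bool (j = 0) else A i j))"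
proof -
  obtain M where NM: "N = Suc M" using N by (cases N) auto
  then have lessN: "0 < N" "Suc k < N \<longleftrightarrow> k < M" for k by auto
  have shift: "(\<Sum>k = 0..<N. f k) = f 0 + (\<Sum>k<M. f (Suc k))" for f :: "nat \<Rightarrow> 'a"
    unfolding NM by (simp only: atLeast0LessThan sum.lessThan_Suc_shift)
  have row': "A i 0 + (\<Sum>k<M. A i (Suc k)) = 0" if "i < N" for i
    using row[OF that] unfolding NM by (simp only: sum.lessThan_Suc_shift)
  have col': "A 0 j + (\<Sum>k<M. A (Suc k) j) = 0" if "j < N" for j
    using col[OF that] unfolding NM by (simp only: sum.lessThan_Suc_shift)
  let ?AJ = "mat N N (\<lambda>(i, j). A i j + x)"
  let ?A1 = "mat N N (\<lambda>(i, j). if i = 0 then 1 else A i j)"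
  let ?A0 = "mat N N (\<lambda>(i, j). if i = 0 then of_bool (j = 0) else A i j)"
  \<comment> \<open>\<open>?R\<close> adds all rows to the first, \<open>?Y\<close> rebuilds the outcome from \<open>?A1\<close>; likewise \<open>?C\<close> adds all columns
    to the first, and \<open>?W\<close> rebuilds the outcome from \<open>?A0 * ?C\<close>.\<close>
  let ?R = "mat N N (\<lambda>(i, j). if i = 0 then 1 else if j = i then 1 else 0) :: 'a mat"
  let ?Y = "mat N N (\<lambda>(i, j). if j = 0 then if i = 0 then x * of_nat N else x
      else if j = i then 1 else 0)"
  let ?C = "mat N N (\<lambda>(i, j). if j = 0 then 1 else if i = j then 1 else 0) :: 'a mat"
  let ?W = "mat N N (\<lambda>(i, j). if i = 0 then if j = 0 then of_nat N else 1
      else if j = i then 1 else 0) :: 'a mat"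
  have prod_shift: "(\<Prod>k = 0..<N. f k) = f 0 * (\<Prod>k<M. f (Suc k))" for f :: "nat \<Rightarrow> 'a"
    unfolding NM by (simp only: atLeast0LessThan prod.lessThan_Suc_shift)
  have detR: "det ?R = 1"
    by (subst det_upper_triangular[of _ N]) (auto simp: prod_list_diag_prod prod_shift lessN)
  have detY: "det ?Y = x * of_nat N"
    by (subst det_lower_triangular[of N]) (auto simp: prod_list_diag_prod prod_shift lessN)
  have detC: "det ?C = 1"
    by (subst det_lower_triangular[of N]) (auto simp: prod_list_diag_prod prod_shift lessN)
  have detW: "det ?W = of_nat N"
    by (subst det_upper_triangular[of _ N]) (auto simp: prod_list_diag_prod prod_shift lessN)
  have RAJ: "?R * ?AJ = ?Y * ?A1"
  proof (rule eq_matI)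
    fix i j assume "i < dim_row (?Y * ?A1)" "j < dim_col (?Y * ?A1)"
    then have ij: "i < N" "j < N" by simp_all
    show "(?R * ?AJ) $$ (i, j) = (?Y * ?A1) $$ (i, j)"
    proof (cases i)
      case 0
      have "(?R * ?AJ) $$ (i, j) = (A 0 j + (\<Sum>k<M. A (Suc k) j)) + x * of_nat N"
        using ij 0 by (simp add: scalar_prod_def shift sum.distrib lessN algebra_simps)
      also have "\<dots> = (?Y * ?A1) $$ (i, j)"
        using ij 0 unfolding col'[OF ij(2)] by (simp add: scalar_prod_def shift lessN)
      finally show ?thesis .
    next
      case (Suc i')
      then have "i' < M" using ij NM by simp
      then show ?thesis
        using ij Suc by (simp add: scalar_prod_def shift lessN if_distrib[of "\<lambda>x. x * _"] cong: if_cong)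
    qed
  qed simp_all
  have "det ?R * det ?AJ = det (?R * ?AJ)"
    by (rule det_mult[of _ N, symmetric]) simp_all
  also have "\<dots> = det ?Y * det ?A1"
    unfolding RAJ by (rule det_mult[of _ N]) simp_all
  finally have 1: "det ?R * det ?AJ = det ?Y * det ?A1" .
  have A1C: "?A1 * ?C = (?A0 * ?C) * ?W"
  proof (rule eq_matI)
    have A0C: "?A0 * ?C = mat N N (\<lambda>(i, j). if i = 0 \<or> j = 0 then of_bool (i = j) else A i j)"
    proof (rule eq_matI)
      fix i j assume "i < dim_row (mat N N (\<lambda>(i, j). if i = 0 \<or> j = 0 then of_bool (i = j) else A i j))"
        "j < dim_col (mat N N (\<lambda>(i, j). if i = 0 \<or> j = 0 then of_bool (i = j) else A i j))"
      then have ij: "i < N" "j < N" by simp_all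
      then show "(?A0 * ?C) $$ (i, j) =
          mat N N (\<lambda>(i, j). if i = 0 \<or> j = 0 then of_bool (i = j) else A i j) $$ (i, j)"
        using row'[OF ij(1)]
        by (cases i; cases j) (simp_all add: scalar_prod_def shift lessN if_distrib[of "\<lambda>x. _ * x"] cong: if_cong)
    qed simp_all
    fix i j assume "i < dim_row ((?A0 * ?C) * ?W)" "j < dim_col ((?A0 * ?C) * ?W)"
    then have ij: "i < N" "j < N" by simp_all
    then show "(?A1 * ?C) $$ (i, j) = ((?A0 * ?C) * ?W) $$ (i, j)"
      unfolding A0C using row'[OF ij(1)]
      by (cases i; cases j) (simp_all add: scalar_prod_def shift lessN if_distrib[of "\<lambda>x. _ * x"] cong: if_cong)
  qed simp_all
  have "det ?A1 * det ?C = det (?A1 * ?C)"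
    by (rule det_mult[of _ N, symmetric]) simp_all
  also have "\<dots> = det (?A0 * ?C) * det ?W"
    unfolding A1C by (rule det_mult[of _ N]) (simp_all add: mult_carrier_mat[of _ N N])
  also have "det (?A0 * ?C) = det ?A0 * det ?C"
    by (rule det_mult[of _ N]) simp_all
  finally have "det ?A1 * det ?C = det ?A0 * det ?C * det ?W" .
  with 1 show ?thesis
    unfolding detR detY detC detW by (simp add: power2_eq_square mult_ac)
qed

lemma laplacian_row_sum:
  assumes "loopless_multigraph G" "u \<in> verts G"
  shows "(\<Sum>w\<in>verts G. laplacian G u w) = (0 :: 'a::comm_ring_1)"
proof -
  have fin: "finite (verts G)" using assms unfolding loopless_multigraph_def by simp
  have "(\<Sum>w\<in>verts G. 2 * of_bool (u = w) - of_bool (w \<in> ends G e)) = (0 :: 'a)"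
    if "e \<in> incident G u" for e
  proof -
    have e: "ends G e \<subseteq> verts G" "card (ends G e) = 2"
      using assms that unfolding loopless_multigraph_def incident_def by auto
    have "(\<Sum>w\<in>verts G. of_bool (w \<in> ends G e)) = (of_nat (card (verts G \<inter> ends G e)) :: 'a)"
      using fin by (simp add: Int_def)
    also have "verts G \<inter> ends G e = ends G e" using e by auto
    finally have "(\<Sum>w\<in>verts G. of_bool (w \<in> ends G e)) = (2 :: 'a)" using e by simp
    moreover have "(\<Sum>w\<in>verts G. 2 * of_bool (u = w)) = (2 :: 'a)"
      using fin \<open>u \<in> verts G\<close> by (simp add: of_bool_def if_distrib cong: if_cong)
    ultimately show ?thesis by (simp add: sum_subtractf)
  qed
  then show ?thesis
    unfolding laplacian_def by (subst sum.swap) simp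
qed

text \<open>Off the diagonal both sides count the edges between \<open>u\<close> and \<open>w\<close>.\<close>

lemma laplacian_commute:
  assumes "loopless_multigraph G"
  shows "laplacian G u w = (laplacian G w u :: 'a::comm_ring_1)"
proof (cases "u = w")
  case False
  have *: "laplacian G u w = (- of_nat (card {e \<in> edges G. u \<in> ends G e \<and> w \<in> ends G e}) :: 'a)"
    if "u \<noteq> w" for u w
    using assms that finite_incident[OF assms, of u] unfolding laplacian_def
    by (simp add: sum_negf incident_def Int_def conj_assoc)
  show ?thesis
    unfolding *[OF False] *[OF False[symmetric]] by (simp add: conj_commute)
qed simp

text \<open>Perturbing by a constant matrix instead of deleting a row and a column keeps the matrix
  block circulant, which is what the Fourier transform below requires.\<close>

lemma det_laplacian_add_constant:
  fixes x :: "'a::idom"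
  assumes G: "loopless_multigraph G" and v: "bij_betw v {..<N} (verts G)" and N: "N > 0"
  shows "det (mat N N (\<lambda>(i, j). laplacian G (v i) (v j) + x)) =
    x * of_nat N ^ 2 * of_nat (num_spanning_trees G)"
proof -
  have vG: "v i \<in> verts G" if "i < N" for i using v that by (auto simp: bij_betw_def)
  have inj: "v i = v j \<longleftrightarrow> i = j" if "i < N" "j < N" for i j
    using v that by (auto simp: bij_betw_def inj_on_def)
  have row: "(\<Sum>j<N. laplacian G (v i) (v j)) = (0 :: 'a)" if "i < N" for i
    using laplacian_row_sum[OF G vG[OF that]] by (simp add: sum.reindex_bij_betw[OF v])
  have "det (mat N N (\<lambda>(i, j). laplacian G (v i) (v j) + x)) = x * of_nat N ^ 2 *
      det (mat N N (\<lambda>(i, j). if i = 0 then of_bool (j = 0) else laplacian G (v i) (v j)))"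
    using N row by (rule det_add_constant) (simp_all add: laplacian_commute[OF G, of "v _" "v _"] row)
  also have "mat N N (\<lambda>(i, j). if i = 0 then of_bool (j = 0) else laplacian G (v i) (v j)) =
      (mat N N (\<lambda>(i, j). if v i = v 0 then of_bool (v j = v 0) else laplacian G (v i) (v j)) :: 'a mat)"
    using N inj by (intro cong_mat) auto
  finally show ?thesis
    using matrix_tree[OF G v vG[OF N], where 'a = 'a] by simp
qed

section \<open>Determinants of block circulant matrices\<close>

lemma det_block_diagonal:
  fixes B :: "nat \<Rightarrow> nat \<Rightarrow> nat \<Rightarrow> 'a::idom"
  shows "det (mat (n * m) (n * m)
      (\<lambda>(a, b). if a div m = b div m then B (a div m) (a mod m) (b mod m) else 0)) =
    (\<Prod>j<n. det (mat m m (\<lambda>(i, l). B j i l)))"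
proof (induction n)
  case (Suc n)
  let ?D = "\<lambda>n. mat (n * m) (n * m)
      (\<lambda>(a, b). if a div m = b div m then B (a div m) (a mod m) (b mod m) else 0)"
  have less: "a div m < n" if "a < n * m" for a
    using that by (simp add: less_mult_imp_div_less)
  have last: "a div m = n \<and> a mod m = a - n * m" if "\<not> a < n * m" "a < m + n * m" for a
  proof -
    define c where "c = a - n * m"
    have "a = c + n * m" "c < m" using that unfolding c_def by linarith+
    then show ?thesis by simp
  qed
  have D: "?D (Suc n) = four_block_mat (?D n) (0\<^sub>m (n * m) m) (0\<^sub>m m (n * m)) (mat m m (\<lambda>(i, l). B n i l))"
  proof (rule eq_matI)
    fix a b
    assume "a < dim_row (four_block_mat (?D n) (0\<^sub>m (n * m) m) (0\<^sub>m m (n * m)) (mat m m (\<lambda>(i, l). B n i l)))"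
      "b < dim_col (four_block_mat (?D n) (0\<^sub>m (n * m) m) (0\<^sub>m m (n * m)) (mat m m (\<lambda>(i, l). B n i l)))"
    then have ab: "a < m + n * m" "b < m + n * m" by simp_all
    then show "?D (Suc n) $$ (a, b) =
        four_block_mat (?D n) (0\<^sub>m (n * m) m) (0\<^sub>m m (n * m)) (mat m m (\<lambda>(i, l). B n i l)) $$ (a, b)"
      using less[of a] less[of b] last[OF _ ab(1)] last[OF _ ab(2)]
      by (cases "a < n * m"; cases "b < n * m") simp_all
  qed (simp_all)
  have "det (?D (Suc n)) = det (?D n) * det (mat m m (\<lambda>(i, l). B n i l))"
    unfolding D by (rule det_four_block_mat_lower_left_zero[of _ "n * m" _ m]) simp_all
  then show ?case using Suc by (simp add: mult.commute)
qed simp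

lemma mult_add_less: "k < n \<Longrightarrow> i < m \<Longrightarrow> k * m + i < n * m" for k n i m :: nat
proof -
  assume "k < n" "i < m"
  then have "k * m + i < Suc k * m" by simp
  also have "\<dots> \<le> n * m" using \<open>k < n\<close> by (intro mult_le_mono1) simp
  finally show ?thesis .
qed

lemma sum_div_mod:
  fixes g :: "nat \<Rightarrow> 'a::comm_monoid_add"
  shows "(\<Sum>a = 0..<n * m. g a) = (\<Sum>k<n. \<Sum>i<m. g (k * m + i))"
proof (induction n)
  case (Suc n)
  have "(\<Sum>a = 0..<Suc n * m. g a) = (\<Sum>a = 0..<n * m. g a) + (\<Sum>a = n * m..<n * m + m. g a)"
    by (subst sum.atLeastLessThan_concat) (simp_all add: add.commute)
  also have "(\<Sum>a = n * m..<n * m + m. g a) = (\<Sum>i<m. g (n * m + i))"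
    using sum.shift_bounds_nat_ivl[of g 0 "n * m" m] by (simp add: atLeast0LessThan add.commute)
  finally show ?case using Suc by simp
qed simp

definition root_of_unity :: "nat \<Rightarrow> complex" where
  "root_of_unity n = cis (2 * pi / real n)"

lemma root_of_unity_power: "root_of_unity n ^ k = cis (2 * pi * real k / real n)"
  unfolding root_of_unity_def DeMoivre by (simp add: mult_ac)

lemma root_of_unity_power_n: "n > 0 \<Longrightarrow> root_of_unity n ^ n = 1"
  unfolding root_of_unity_power by simp

lemma root_of_unity_cnj: "cnj (root_of_unity n) * root_of_unity n = 1"
  unfolding root_of_unity_def by (simp add: cis_cnj cis_mult)

lemma root_of_unity_inj: "inj_on (\<lambda>k. root_of_unity n ^ k) {..<n}"
  unfolding root_of_unity_power using bij_betw_roots_unity[of n]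
  by (cases "n = 0") (auto simp: bij_betw_def)

text \<open>A geometric series in \<open>z = w\<^sup>p * w\<^sup>-\<^sup>q\<close>, where \<open>w\<close> is the primitive root: either
  \<open>z = 1\<close>, or the sum vanishes because \<open>z\<^sup>n = 1\<close>.\<close>

lemma sum_root_of_unity:
  assumes "p < n" "q < n"
  shows "(\<Sum>k<n. root_of_unity n ^ (p * k) * cnj (root_of_unity n) ^ (k * q)) =
    (if p = q then of_nat n else 0)"
proof -
  let ?w = "root_of_unity n"
  define z where "z = ?w ^ p * cnj ?w ^ q"
  have inv: "?w ^ k * cnj ?w ^ k = 1" for k
    using root_of_unity_cnj[of n] by (simp flip: power_mult_distrib add: mult.commute)
  have "z = 1 \<longleftrightarrow> p = q"
  proof
    assume "z = 1"
    then have "?w ^ p * (?w ^ q * cnj ?w ^ q) = ?w ^ q" unfolding z_def by (simp add: mult_ac)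
    then have "?w ^ p = ?w ^ q" unfolding inv by simp
    then show "p = q" using inj_onD[OF root_of_unity_inj[of n]] assms by auto
  qed (simp add: z_def inv)
  have "(?w ^ n) ^ p = 1" "(cnj ?w ^ n) ^ q = 1"
    using root_of_unity_power_n[of n] assms by (simp_all flip: complex_cnj_power)
  then have zn: "z ^ n = 1"
    unfolding z_def by (simp add: power_mult_distrib mult.commute flip: power_mult)
  have "(\<Sum>k<n. ?w ^ (p * k) * cnj ?w ^ (k * q)) = (\<Sum>k<n. z ^ k)"
    unfolding z_def by (simp add: power_mult_distrib power_mult[symmetric] mult.commute)
  also have "\<dots> = (if p = q then of_nat n else 0)"
    using geometric_sum[of z n] zn \<open>z = 1 \<longleftrightarrow> p = q\<close> by (cases "z = 1") auto
  finally show ?thesis .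
qed

text \<open>The hypothesis says that the block vectors built from the powers of a root of unity
  are carried by \<open>M\<close> to block multiples of themselves, so the discrete Fourier transform conjugates
  \<open>M\<close> to a block diagonal matrix.\<close>

lemma det_fourier_blocks:
  fixes M :: "nat \<Rightarrow> nat \<Rightarrow> complex" and n m :: nat
  defines "w \<equiv> root_of_unity n"
  assumes n: "n > 0"
    and M: "\<And>k i j l. k < n \<Longrightarrow> i < m \<Longrightarrow> j < n \<Longrightarrow> l < m \<Longrightarrow>
      (\<Sum>k'<n. M (k * m + i) (k' * m + l) * w ^ (k' * j)) = w ^ (k * j) * B j i l"
  shows "det (mat (n * m) (n * m) (\<lambda>(a, b). M a b)) = (\<Prod>j<n. det (mat m m (\<lambda>(i, l). B j i l)))"
proof -
  let ?N = "n * m"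
  let ?M = "mat ?N ?N (\<lambda>(a, b). M a b)"
  let ?D = "mat ?N ?N (\<lambda>(a, b). if a div m = b div m then B (a div m) (a mod m) (b mod m) else 0)"
  let ?F = "mat ?N ?N (\<lambda>(a, b). if a mod m = b mod m then w ^ ((a div m) * (b div m)) else 0)"
  let ?F' = "mat ?N ?N (\<lambda>(a, b). if a mod m = b mod m then cnj w ^ ((a div m) * (b div m)) else 0)"
  have bounds: "a div m < n" "a mod m < m" "a div m * m + a mod m = a" if "a < ?N" for a
    using that by (simp_all add: less_mult_imp_div_less)
      (metis mod_less_divisor mult_0_right not_gr_zero not_less_zero)
  have MF: "?M * ?F = ?F * ?D"
  proof (rule eq_matI)
    fix a b assume "a < dim_row (?F * ?D)" "b < dim_col (?F * ?D)"
    then have ab: "a < ?N" "b < ?N" by simp_all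
    note a = bounds[OF ab(1)] and b = bounds[OF ab(2)]
    have "(?M * ?F) $$ (a, b) = (\<Sum>c = 0..<?N. M a c * ?F $$ (c, b))"
      using ab by (simp add: scalar_prod_def)
    also have "\<dots> = (\<Sum>k'<n. \<Sum>i'<m. if i' = b mod m then M a (k' * m + b mod m) * w ^ (k' * (b div m)) else 0)"
      unfolding sum_div_mod using ab mult_add_less by (intro sum.cong refl) auto
    also have "\<dots> = (\<Sum>k'<n. M a (k' * m + b mod m) * w ^ (k' * (b div m)))"
      using b by simp
    also have "\<dots> = w ^ ((a div m) * (b div m)) * B (b div m) (a mod m) (b mod m)"
      using M[OF a(1,2) b(1,2)] a(3) by simp
    also have "\<dots> = (\<Sum>k'<n. \<Sum>i'<m. if k' = b div m \<and> i' = a mod m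
        then w ^ ((a div m) * (b div m)) * B (b div m) (a mod m) (b mod m) else 0)"
    proof -
      have "(\<Sum>i'<m. if k' = b div m \<and> i' = a mod m then c else 0) = (if k' = b div m then c else 0)"
        for c :: complex and k'
        using a(2) by (cases "k' = b div m") auto
      then show ?thesis using b(1) by simp
    qed
    also have "\<dots> = (\<Sum>c = 0..<?N. ?F $$ (a, c) * ?D $$ (c, b))"
      unfolding sum_div_mod using ab mult_add_less by (intro sum.cong refl) auto
    also have "\<dots> = (?F * ?D) $$ (a, b)"
      using ab by (simp add: scalar_prod_def)
    finally show "(?M * ?F) $$ (a, b) = (?F * ?D) $$ (a, b)" .
  qed simp_all
  \<comment> \<open>Up to the factor \<open>n\<close>, the inverse of the Fourier matrix is its conjugate.\<close>
  have FF: "?F * ?F' = of_nat n \<cdot>\<^sub>m 1\<^sub>m ?N"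
  proof (rule eq_matI)
    fix a b assume "a < dim_row (of_nat n \<cdot>\<^sub>m 1\<^sub>m ?N :: complex mat)"
      "b < dim_col (of_nat n \<cdot>\<^sub>m 1\<^sub>m ?N :: complex mat)"
    then have ab: "a < ?N" "b < ?N" by simp_all
    note a = bounds[OF ab(1)] and b = bounds[OF ab(2)]
    have eq_iff: "a = b \<longleftrightarrow> a div m = b div m \<and> a mod m = b mod m"
      using a(3) b(3) by metis
    have "(?F * ?F') $$ (a, b) = (\<Sum>c = 0..<?N. ?F $$ (a, c) * ?F' $$ (c, b))"
      using ab by (simp add: scalar_prod_def)
    also have "\<dots> = (\<Sum>k'<n. \<Sum>i'<m. if i' = a mod m then if a mod m = b mod m
        then w ^ (a div m * k') * cnj w ^ (k' * (b div m)) else 0 else 0)"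
      unfolding sum_div_mod using ab mult_add_less by (intro sum.cong refl) auto
    also have "\<dots> = (\<Sum>k'<n. if a mod m = b mod m
        then w ^ (a div m * k') * cnj w ^ (k' * (b div m)) else 0)"
      using a by simp
    also have "\<dots> = (of_nat n \<cdot>\<^sub>m 1\<^sub>m ?N) $$ (a, b)"
      using sum_root_of_unity[OF a(1) b(1)] ab eq_iff
      unfolding w_def by (cases "a mod m = b mod m") simp_all
    finally show "(?F * ?F') $$ (a, b) = (of_nat n \<cdot>\<^sub>m 1\<^sub>m ?N) $$ (a, b)" .
  qed simp_all
  have "det ?F * det ?F' = det (of_nat n \<cdot>\<^sub>m 1\<^sub>m ?N)"
    unfolding FF[symmetric] by (rule det_mult[of _ ?N, symmetric]) simp_all
  also have "\<dots> \<noteq> 0" using n by simp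
  finally have F: "det ?F \<noteq> 0" by auto
  have "det ?M * det ?F = det (?M * ?F)" by (rule det_mult[of _ ?N, symmetric]) simp_all
  also have "\<dots> = det ?F * det ?D" unfolding MF by (rule det_mult[of _ ?N]) simp_all
  finally have "det ?M = det ?D" using F by simp
  then show ?thesis unfolding det_block_diagonal .
qed

section \<open>The Laplacian of a circulant foliation\<close>

lemma add_mod_eq:
  fixes k n x :: nat
  assumes "k < n" "1 \<le> x" "2 * x \<le> n"
  shows "(k + x) mod n = (if k + x < n then k + x else k + x - n)"
    and "(k + n - x) mod n = (if x \<le> k then k - x else k + n - x)"
proof -
  show "(k + x) mod n = (if k + x < n then k + x else k + x - n)"
    using assms by (simp add: le_mod_geq)
  show "(k + n - x) mod n = (if x \<le> k then k - x else k + n - x)"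
  proof (cases "x \<le> k")
    case True
    then have "k + n - x = (k - x) + n" by simp
    then have "(k + n - x) mod n = (k - x) mod n" by (metis mod_add_self2)
    then show ?thesis using assms True by simp
  qed (use assms in simp)
qed

text \<open>A jump \<open>x\<close> contributes two edges at each vertex, also if \<open>2 * x = n\<close>, when these are
  parallel.\<close>

lemma circulant_ends_iff:
  fixes k k' n x :: nat
  assumes "k < n" "k' < n" "1 \<le> x" "2 * x \<le> n"
  shows "(k' + x) mod n = k \<longleftrightarrow> k' = (k + n - x) mod n"
  unfolding add_mod_eq(1)[OF assms(2-4)] add_mod_eq(2)[OF assms(1,3,4)]
  using assms by auto

lemma circulant_ends_neq:
  fixes k n x :: nat
  assumes "k < n" "1 \<le> x" "2 * x \<le> n"
  shows "(k + x) mod n \<noteq> k" "(k + n - x) mod n \<noteq> k"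
  unfolding add_mod_eq[OF assms] using assms by auto

lemma power_mod_root_of_unity:
  fixes w :: "'a::monoid_mult"
  assumes "w ^ n = 1"
  shows "w ^ (k mod n) = w ^ k"
proof -
  have "w ^ k = w ^ (n * (k div n) + k mod n)" by simp
  also have "\<dots> = w ^ (k mod n)" unfolding power_add power_mult assms by simp
  finally show ?thesis by simp
qed

context
  fixes H :: "(nat, 'e) multigraph" and n m :: nat and s :: "nat \<Rightarrow> nat list"
  assumes H: "loopless_multigraph H" and verts: "verts H = {..<m}"
    and s: "\<And>i x. i < m \<Longrightarrow> x \<in> set (s i) \<Longrightarrow> 1 \<le> x \<and> 2 * x \<le> n"
begin

abbreviation (input) Hn :: "(nat \<times> nat, (nat \<times> 'e) + (nat \<times> (nat \<times> nat))) multigraph" where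
  "Hn \<equiv> circulant_foliation n H s"

lemma verts_foliation: "verts Hn = {..<n} \<times> {..<m}"
  by (simp add: circulant_foliation_def foliation_def verts)

lemma edges_foliation:
  "edges Hn = Inl ` ({..<n} \<times> edges H) \<union> Inr ` (SIGMA i:{..<m}. {..<n} \<times> set (s i))"
  by (simp add: circulant_foliation_def foliation_def circulant_def verts)

lemma ends_foliation:
  "ends Hn (Inl (k, e)) = Pair k ` ends H e"
  "ends Hn (Inr (i, (k, x))) = {(k, i), ((k + x) mod n, i)}"
  by (simp_all add: circulant_foliation_def foliation_def circulant_def)

lemma loopless_foliation: "loopless_multigraph Hn"
proof -
  have "ends Hn c \<subseteq> verts Hn \<and> card (ends Hn c) = 2" if "c \<in> edges Hn" for c
  proof -
    from that consider k e where "c = Inl (k, e)" "k < n" "e \<in> edges H"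
      | i k x where "c = Inr (i, (k, x))" "i < m" "k < n" "x \<in> set (s i)"
      unfolding edges_foliation by auto
    then show ?thesis
    proof cases
      case 1
      then have "ends H e \<subseteq> {..<m}" "card (ends H e) = 2"
        using H verts unfolding loopless_multigraph_def by auto
      moreover have "card (Pair k ` ends H e) = card (ends H e)"
        by (rule card_image) (simp add: inj_on_def)
      ultimately show ?thesis using 1 by (auto simp: ends_foliation verts_foliation)
    next
      case 2
      then have "(k + x) mod n \<noteq> k" using circulant_ends_neq(1) s by simp
      then show ?thesis using 2 by (auto simp: ends_foliation verts_foliation)
    qed
  qed
  moreover have "finite (edges Hn)" "finite (verts Hn)"
    using H unfolding edges_foliation verts_foliation loopless_multigraph_def by auto
  ultimately show ?thesis unfolding loopless_multigraph_def by blast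
qed

text \<open>The edges at \<open>(k, i)\<close> are those of layer \<open>k\<close> at \<open>i\<close> and, for each jump, one leaving and one
  entering \<open>k\<close> in the fiber.\<close>

lemma sum_incident_foliation:
  fixes \<phi> :: "_ \<Rightarrow> 'a::comm_monoid_add"
  assumes "k < n" "i < m"
  shows "(\<Sum>c\<in>incident Hn (k, i). \<phi> c) = (\<Sum>e\<in>incident H i. \<phi> (Inl (k, e))) +
    (\<Sum>x\<in>set (s i). \<phi> (Inr (i, (k, x))) + \<phi> (Inr (i, ((k + n - x) mod n, x))))"
proof -
  let ?A = "(\<lambda>e. Inl (k, e)) ` incident H i :: ((nat \<times> 'e) + (nat \<times> (nat \<times> nat))) set"
  let ?B = "(\<lambda>x. Inr (i, (k, x))) ` set (s i) :: ((nat \<times> 'e) + (nat \<times> (nat \<times> nat))) set"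
  let ?C = "(\<lambda>x. Inr (i, ((k + n - x) mod n, x))) ` set (s i) :: ((nat \<times> 'e) + (nat \<times> (nat \<times> nat))) set"
  have sx: "1 \<le> x" "2 * x \<le> n" if "x \<in> set (s i)" for x using s[OF assms(2) that] by auto
  have inc: "incident Hn (k, i) = ?A \<union> (?B \<union> ?C)"
  proof (rule Set.set_eqI)
    fix c
    show "c \<in> incident Hn (k, i) \<longleftrightarrow> c \<in> ?A \<union> (?B \<union> ?C)"
    proof (cases c)
      case (Inl a)
      obtain k' e where "a = (k', e)" by (cases a)
      then show ?thesis
        using Inl assms(1) by (auto simp: incident_def edges_foliation ends_foliation)
    next
      case (Inr a)
      obtain i' k' x where a: "a = (i', (k', x))" by (cases a) auto
      have iff: "(k' + x) mod n = k \<longleftrightarrow> k' = (k + n - x) mod n" if "k' < n" "x \<in> set (s i)"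
        using circulant_ends_iff[OF assms(1) that(1) sx[OF that(2)]] .
      have "(k + n - x) mod n < n" using assms by simp
      then show ?thesis
        using Inr a assms iff
        by (auto simp: incident_def edges_foliation ends_foliation)
    qed
  qed
  have neq: "k \<noteq> (k + n - x) mod n" if "x \<in> set (s i)" for x
    using circulant_ends_neq(2)[OF assms(1) sx[OF that]] by simp
  have fin: "finite ?A" "finite ?B" "finite ?C" using finite_incident[OF H] by auto
  have "(\<Sum>c\<in>incident Hn (k, i). \<phi> c) = sum \<phi> ?A + sum \<phi> (?B \<union> ?C)"
    unfolding inc using fin by (intro sum.union_disjoint) auto
  also have "sum \<phi> (?B \<union> ?C) = sum \<phi> ?B + sum \<phi> ?C"
    using fin by (intro sum.union_disjoint) (auto dest: neq)
  also have "sum \<phi> ?A = (\<Sum>e\<in>incident H i. \<phi> (Inl (k, e)))"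
    by (subst sum.reindex) (auto simp: inj_on_def)
  also have "sum \<phi> ?B = (\<Sum>x\<in>set (s i). \<phi> (Inr (i, (k, x))))"
    by (subst sum.reindex) (auto simp: inj_on_def)
  also have "sum \<phi> ?C = (\<Sum>x\<in>set (s i). \<phi> (Inr (i, ((k + n - x) mod n, x))))"
    by (subst sum.reindex) (auto simp: inj_on_def)
  finally show ?thesis by (simp add: sum.distrib)
qed

text \<open>Along a fiber, the vector \<open>k \<mapsto> w\<^sup>k\<close> is an eigenvector of each shift by a jump, so the
  blocks of the Fourier transform are the Laplacian of \<open>H\<close> with the eigenvalues
  \<open>2 - w\<^sup>x - w\<^sup>-\<^sup>x\<close> of the jumps added on the diagonal.\<close>

lemma foliation_laplacian_power:
  fixes w :: complex
  assumes w: "w ^ n = 1" and k: "k < n" and i: "i < m" and l: "l < m"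
  shows "(\<Sum>k'<n. laplacian Hn (k, i) (k', l) * w ^ k') =
    w ^ k * (laplacian H i l + of_bool (i = l) * (\<Sum>x\<in>set (s i). 2 - w ^ x - inverse w ^ x))"
proof -
  have n: "n > 0" using k by simp
  have w0: "w \<noteq> 0" using w n by (metis power_0_left zero_neq_one less_not_refl)
  let ?\<psi> = "\<lambda>c. \<Sum>k'<n. (2 * of_bool ((k, i) = (k', l)) - of_bool ((k', l) \<in> ends Hn c)) * w ^ k'"
  have pick: "(\<Sum>k'<n. of_bool (k' = k1) * w ^ k') = w ^ k1" if "k1 < n" for k1
    using that by (simp add: of_bool_def if_distrib[of "\<lambda>x. x * _"] cong: if_cong)
  have Inl: "?\<psi> (Inl (k, e)) = w ^ k * (2 * of_bool (i = l) - of_bool (l \<in> ends H e))" for e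
  proof -
    have "?\<psi> (Inl (k, e)) = (\<Sum>k'<n. (2 * of_bool (i = l) - of_bool (l \<in> ends H e)) *
        (of_bool (k' = k) * w ^ k'))"
      by (intro sum.cong refl) (auto simp: ends_foliation)
    also have "\<dots> = (2 * of_bool (i = l) - of_bool (l \<in> ends H e)) * w ^ k"
      by (subst sum_distrib_left[symmetric]) (simp only: pick[OF k])
    finally show ?thesis by simp
  qed
  have Inr: "?\<psi> (Inr (i, (k1, x))) = of_bool (i = l) * (2 * w ^ k - w ^ k1 - w ^ ((k1 + x) mod n))"
    if "k1 < n" "(k1 + x) mod n \<noteq> k1" for k1 x
  proof -
    have "?\<psi> (Inr (i, (k1, x))) = (\<Sum>k'<n. of_bool (i = l) * (2 * (of_bool (k' = k) * w ^ k') -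
        of_bool (k' = k1) * w ^ k' - of_bool (k' = (k1 + x) mod n) * w ^ k'))"
      using that(2) by (intro sum.cong refl) (auto simp: ends_foliation)
    also have "\<dots> = of_bool (i = l) * (2 * w ^ k - w ^ k1 - w ^ ((k1 + x) mod n))"
      unfolding sum_distrib_left[symmetric] sum_subtractf pick[OF k] pick[OF that(1)]
        pick[OF mod_less_divisor[OF n]] ..
    finally show ?thesis .
  qed
  have jump: "?\<psi> (Inr (i, (k, x))) + ?\<psi> (Inr (i, ((k + n - x) mod n, x))) =
      w ^ k * (of_bool (i = l) * (2 - w ^ x - inverse w ^ x))" if x: "x \<in> set (s i)" for x
  proof -
    have x': "1 \<le> x" "2 * x \<le> n" using s[OF i x] by auto
    let ?k1 = "(k + n - x) mod n"
    have k1: "?k1 < n" "(?k1 + x) mod n = k"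
      using n circulant_ends_iff[OF k _ x', of ?k1] by simp_all
    have up: "w ^ ((k + x) mod n) = w ^ k * w ^ x"
      unfolding power_mod_root_of_unity[OF w] power_add ..
    have "w ^ ?k1 * w ^ x = w ^ ((?k1 + x) mod n)"
      unfolding power_mod_root_of_unity[OF w, of "?k1 + x"] power_add ..
    then have down: "w ^ ?k1 = w ^ k * inverse w ^ x"
      unfolding k1(2) using w0 by (simp add: power_inverse field_simps)
    show ?thesis
      unfolding Inr[OF k circulant_ends_neq(1)[OF k x']]
      using Inr[OF k1(1), of x] circulant_ends_neq(2)[OF k x'] k1(2) up down
      by (simp add: algebra_simps)
  qed
  have "(\<Sum>k'<n. laplacian Hn (k, i) (k', l) * w ^ k') = (\<Sum>c\<in>incident Hn (k, i). ?\<psi> c)"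
    unfolding laplacian_def sum_distrib_right by (rule sum.swap)
  also have "\<dots> = (\<Sum>e\<in>incident H i. w ^ k * (2 * of_bool (i = l) - of_bool (l \<in> ends H e))) +
      (\<Sum>x\<in>set (s i). w ^ k * (of_bool (i = l) * (2 - w ^ x - inverse w ^ x)))"
    unfolding sum_incident_foliation[OF k i] Inl using jump
    by (intro arg_cong2[where f = "(+)"] refl sum.cong) simp_all
  finally show ?thesis
    unfolding laplacian_def by (simp add: sum_distrib_left distrib_left)
qed

end

section \<open>Integer polynomials at sums of a root of unity and its inverse\<close>

abbreviation eval_int :: "int poly \<Rightarrow> 'a::comm_ring_1 \<Rightarrow> 'a" where
  "eval_int p t \<equiv> poly (map_poly of_int p) t"

lemma eval_int_simps [simp]:
  "eval_int (p + q) t = eval_int p t + eval_int q t"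
  "eval_int (p - q) t = eval_int p t - eval_int q t"
  "eval_int (p * q) t = eval_int p t * eval_int q t"
  "eval_int (pCons c p) t = of_int c + t * eval_int p t"
  "eval_int (- p) t = - eval_int p t"
  by (simp_all add: of_int_poly_hom.hom_uminus of_int_poly_hom.hom_add of_int_poly_hom.hom_minus of_int_poly_hom.hom_mult of_int_hom.map_poly_pCons_hom)

interpretation eval_int_hom: comm_ring_hom "\<lambda>p. eval_int p t"
  by unfold_locales simp_all

lemma eval_int_numeral [simp]: "eval_int (numeral k) t = numeral k"
  by (metis eval_int_hom.hom_of_nat of_nat_numeral)

lemma eval_int_of_int: "eval_int p (of_int c) = (of_int (poly p c) :: 'a::comm_ring_1)"
  by (rule of_int_hom.poly_map_poly)

text \<open>Multiplication by \<open>G\<close> acts on the residues modulo \<open>U\<close> by an integer matrix.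
  The roots of \<open>U\<close> diagonalise this matrix, with Vandermonde eigenvectors and
  eigenvalues \<open>G (t j)\<close>.\<close>

lemma prod_eval_roots_integer:
  fixes G U :: "int poly" and t :: "nat \<Rightarrow> complex"
  assumes U: "lead_coeff U = 1" "degree U = N"
    and inj: "inj_on t {..<N}" and root: "\<And>j. j < N \<Longrightarrow> eval_int U (t j) = 0"
  shows "\<exists>c::int. (\<Prod>j<N. eval_int G (t j)) = of_int c"
proof -
  have "\<exists>r. degree r < N \<and> (\<forall>j<N. eval_int r (t j) = eval_int G (t j) * t j ^ i)" if "i < N" for i
  proof -
    let ?f = "monom 1 i * G"
    obtain q r where qr: "pseudo_divmod ?f U = (q, r)" by (cases "pseudo_divmod ?f U")
    have "U \<noteq> 0" using U(1) by auto
    note pd = pseudo_divmod[OF this qr]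
    have f: "?f = U * q + r" using pd(1) U by simp
    have deg: "degree r < N" using pd(2) U that by auto
    have "eval_int r (t j) = eval_int G (t j) * t j ^ i" if "j < N" for j
    proof -
      have "eval_int ?f (t j) = eval_int r (t j)" unfolding f using root[OF that] by simp
      then show ?thesis by (simp add: poly_monom of_int_hom.map_poly_hom_monom mult.commute)
    qed
    then show ?thesis using deg by auto
  qed
  then obtain r where r: "\<And>i. i < N \<Longrightarrow> degree (r i) < N"
    "\<And>i j. i < N \<Longrightarrow> j < N \<Longrightarrow> eval_int (r i) (t j) = eval_int G (t j) * t j ^ i"
    by metis
  let ?V = "mat N N (\<lambda>(j, k). t j ^ k)"
  let ?B = "mat N N (\<lambda>(k, i). coeff (r i) k)"
  let ?D = "mat N N (\<lambda>(i, j). if i = j then eval_int G (t i) else 0)"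
  have VB: "?V * map_mat of_int ?B = ?D * ?V"
  proof (rule eq_matI)
    fix j i assume "j < dim_row (?D * ?V)" "i < dim_col (?D * ?V)"
    then have ij: "j < N" "i < N" by simp_all
    have "degree (map_poly of_int (r i) :: complex poly) < N"
      using r(1)[OF ij(2)] degree_map_poly_le le_less_trans by blast
    then have "eval_int (r i) (t j) = (\<Sum>k = 0..<N. coeff (map_poly of_int (r i)) k * t j ^ k)"
      unfolding poly_altdef by (intro sum.mono_neutral_left) (auto simp: coeff_eq_0)
    also have "\<dots> = (\<Sum>k = 0..<N. of_int (coeff (r i) k) * t j ^ k)"
      by (simp add: coeff_map_poly)
    finally have "(?V * map_mat of_int ?B) $$ (j, i) = eval_int (r i) (t j)"
      using ij by (simp add: scalar_prod_def mult.commute)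
    also have "\<dots> = (?D * ?V) $$ (j, i)"
      using ij r(2)[OF ij(2,1)]
      by (simp add: scalar_prod_def if_distrib[of "\<lambda>x. x * _"] cong: if_cong)
    finally show "(?V * map_mat of_int ?B) $$ (j, i) = (?D * ?V) $$ (j, i)" .
  qed simp_all
  \<comment> \<open>A kernel vector would be a polynomial of degree below \<open>N\<close> with \<open>N\<close> roots.\<close>
  have V: "det ?V \<noteq> 0"
  proof
    assume "det ?V = 0"
    then obtain x where x: "x \<in> carrier_vec N" "x \<noteq> 0\<^sub>v N" "?V *\<^sub>v x = 0\<^sub>v N"
      using det_0_iff_vec_prod_zero[of ?V N] by auto
    define p where "p = (\<Sum>k<N. monom (x $ k) k)"
    have coeff_p: "coeff p k = (if k < N then x $ k else 0)" for k
      unfolding p_def by (simp add: coeff_sum)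
    have "N > 0" using x(1,2) by (cases N) auto
    have "degree p \<le> N - 1" by (rule degree_le) (use \<open>N > 0\<close> coeff_p in auto)
    have "poly p (t j) = poly 0 (t j)" if "j < N" for j
    proof -
      have "(?V *\<^sub>v x) $ j = 0" unfolding x(3) using that by simp
      then show ?thesis
        using that x(1) unfolding p_def
        by (simp add: scalar_prod_def poly_sum poly_monom mult.commute atLeast0LessThan)
    qed
    then have "p = 0"
      using \<open>degree p \<le> N - 1\<close> \<open>N > 0\<close> card_image[OF inj]
      by (intro poly_eqI_degree[of "t ` {..<N}"]) auto
    then have "x $ k = 0" if "k < N" for k using coeff_p[of k] that by simp
    then have "x = 0\<^sub>v N" using x(1) by (intro eq_vecI) auto
    then show False using x(2) by simp
  qed
  have "det ?V * det (map_mat of_int ?B) = det (?V * map_mat of_int ?B)"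
    by (rule det_mult[of _ N, symmetric]) simp_all
  also have "\<dots> = det ?D * det ?V"
    unfolding VB by (rule det_mult[of _ N]) simp_all
  finally have "det ?D = of_int (det ?B)"
    using V by simp
  moreover have "det ?D = (\<Prod>j<N. eval_int G (t j))"
    by (subst det_upper_triangular[of _ N]) (auto simp: prod_list_diag_prod atLeast0LessThan)
  ultimately show ?thesis by auto
qed

text \<open>The polynomials of \<open>z\<^sup>k + z\<^sup>-\<^sup>k\<close> and \<open>(z\<^sup>k - z\<^sup>-\<^sup>k) / (z - z\<^sup>-\<^sup>1)\<close> in \<open>z + z\<^sup>-\<^sup>1\<close>: the
  Chebyshev polynomials of both kinds in half the variable.  They have leading coefficient \<open>1\<close>
  (except for the constant \<open>2\<close>), so division by them stays within the integers.\<close>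

fun power_sum_poly :: "nat \<Rightarrow> int poly" where
  "power_sum_poly 0 = [:2:]"
| "power_sum_poly (Suc 0) = [:0, 1:]"
| "power_sum_poly (Suc (Suc k)) = [:0, 1:] * power_sum_poly (Suc k) - power_sum_poly k"

fun power_quot_poly :: "nat \<Rightarrow> int poly" where
  "power_quot_poly 0 = 0"
| "power_quot_poly (Suc 0) = 1"
| "power_quot_poly (Suc (Suc k)) = [:0, 1:] * power_quot_poly (Suc k) - power_quot_poly k"

lemma eval_power_sum_poly:
  fixes z y :: "'a::comm_ring_1"
  assumes "z * y = 1"
  shows "eval_int (power_sum_poly k) (z + y) = z ^ k + y ^ k"
proof (induction k rule: power_sum_poly.induct)
  case (3 k)
  have "(z + y) * (z * z ^ k + y * y ^ k) - (z ^ k + y ^ k) =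
      z * (z * z ^ k) + y * (y * y ^ k) + (z * y - 1) * (z ^ k + y ^ k)"
    by (simp add: algebra_simps)
  then show ?case using 3 assms by simp
qed simp_all

lemma eval_power_quot_poly:
  fixes z y :: "'a::comm_ring_1"
  assumes "z * y = 1"
  shows "(z - y) * eval_int (power_quot_poly k) (z + y) = z ^ k - y ^ k"
proof (induction k rule: power_quot_poly.induct)
  case (3 k)
  have "(z - y) * eval_int (power_quot_poly (Suc (Suc k))) (z + y) =
      (z + y) * ((z - y) * eval_int (power_quot_poly (Suc k)) (z + y)) -
      (z - y) * eval_int (power_quot_poly k) (z + y)"
    by (simp add: algebra_simps)
  also have "\<dots> = (z + y) * (z ^ Suc k - y ^ Suc k) - (z ^ k - y ^ k)"
    unfolding 3 ..
  also have "\<dots> = z ^ Suc (Suc k) - y ^ Suc (Suc k) + (z * y - 1) * (z ^ k - y ^ k)"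
    by (simp add: algebra_simps)
  finally show ?case using assms by simp
qed simp_all

lemma power_quot_poly_monic:
  "degree (power_quot_poly (Suc k)) = k \<and> lead_coeff (power_quot_poly (Suc k)) = 1"
proof (induction k rule: less_induct)
  case (less k)
  consider "k = 0" | "k = Suc 0" | j where "k = Suc (Suc j)"
    by (metis not0_implies_Suc)
  then show ?case
  proof cases
    case (3 j)
    let ?p = "[:0, 1:] * power_quot_poly (Suc (Suc j))" and ?q = "power_quot_poly (Suc j)"
    have q: "degree ?q = j" using less[of j] 3 by simp
    have p: "degree ?p = k" "lead_coeff ?p = 1"
      using less[of "Suc j"] 3 by (auto simp: degree_pCons_eq_if split: if_splits simp del: power_quot_poly.simps)
    have lt: "degree ?q < degree ?p" using p q 3 by simp
    have eq: "power_quot_poly (Suc k) = ?p - ?q" using 3 by simp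
    have "degree (?p - ?q) = k"
      using degree_add_eq_left[of "- ?q" ?p] lt p by simp
    moreover have "coeff (?p - ?q) k = 1"
      using p lt coeff_eq_0[of ?q k] by simp
    ultimately show ?thesis unfolding eq by simp
  qed simp_all
qed

text \<open>The sums of an \<open>n\<close>-th root of unity other than \<open>1\<close> and \<open>-1\<close> and its inverse are the roots
  of this monic integer polynomial.\<close>

definition half_poly :: "nat \<Rightarrow> int poly" where
  "half_poly n = power_quot_poly (Suc ((n - 1) div 2)) +
     (if odd n then power_quot_poly ((n - 1) div 2) else 0)"

lemma half_poly_monic:
  "degree (half_poly n) = (n - 1) div 2" "lead_coeff (half_poly n) = 1"
proof -
  let ?N = "(n - 1) div 2"
  let ?q = "if odd n then power_quot_poly ?N else 0"
  note p = power_quot_poly_monic[of ?N]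
  have "degree ?q < ?N \<or> ?q = 0"
    using power_quot_poly_monic[of "?N - 1"] by (cases ?N) auto
  then show *: "degree (half_poly n) = ?N"
    unfolding half_poly_def using p degree_add_eq_left[of ?q "power_quot_poly (Suc ?N)"] by auto
  have "coeff ?q ?N = 0"
    using \<open>degree ?q < ?N \<or> ?q = 0\<close> coeff_eq_0[of ?q ?N] by auto
  moreover have "coeff (power_quot_poly (Suc ?N)) ?N = 1" using p by metis
  ultimately show "lead_coeff (half_poly n) = 1"
    unfolding * by (simp add: half_poly_def)
qed

text \<open>The quotients defining \<open>half_poly\<close> give, up to the factor \<open>z - y\<close>, differences \<open>z\<^sup>a - y\<^sup>a\<close>.
  These cancel because \<open>z\<^sup>a = y\<^sup>b\<close> whenever \<open>a + b = n\<close>.\<close>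

lemma half_poly_root:
  fixes z y :: complex
  assumes "z ^ n = 1" "z * y = 1" "z \<noteq> y" "n > 0"
  shows "eval_int (half_poly n) (z + y) = 0"
proof -
  let ?N = "(n - 1) div 2"
  have "(z - y) * eval_int (half_poly n) (z + y) =
      z ^ Suc ?N - y ^ Suc ?N + (if odd n then z ^ ?N - y ^ ?N else 0)"
    unfolding half_poly_def by (simp add: distrib_left eval_power_quot_poly[OF assms(2)] del: power_Suc)
  also have "\<dots> = 0"
  proof -
    have conj: "z ^ a = y ^ b" if "a + b = n" for a b
    proof -
      have "z ^ a * (z * y) ^ b = z ^ n * y ^ b"
        unfolding that[symmetric] by (simp add: power_mult_distrib power_add)
      then show ?thesis using assms by simp
    qed
    show ?thesis
    proof (cases "odd n")
      case True
      then have "Suc ?N + ?N = n" "?N + Suc ?N = n" by (auto elim!: oddE)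
      then show ?thesis using conj[of "Suc ?N" ?N] conj[of ?N "Suc ?N"] True by simp
    next
      case False
      then have "Suc ?N + Suc ?N = n" using assms(4) by presburger
      then show ?thesis using conj[of "Suc ?N" "Suc ?N"] False by simp
    qed
  qed
  finally show ?thesis using assms(3) by simp
qed

definition unity_sum :: "nat \<Rightarrow> nat \<Rightarrow> complex" where
  "unity_sum n j = root_of_unity n ^ j + inverse (root_of_unity n ^ j)"

lemma root_of_unity_nonzero: "root_of_unity n \<noteq> 0"
  unfolding root_of_unity_def by simp

lemma root_of_unity_power_eq_1:
  assumes "0 < j" "j < n"
  shows "root_of_unity n ^ j \<noteq> 1"
  using inj_onD[OF root_of_unity_inj[of n], of j 0] assms by auto

text \<open>The factors range over all roots of \<open>half_poly n\<close>, one for each pair of conjugate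
  roots of unity other than \<open>1\<close> and \<open>-1\<close>.  This integrality is what makes the squares in the
  main result squares of integers.\<close>

lemma half_product_integer:
  "\<exists>c::int. (\<Prod>j<(n - 1) div 2. eval_int G (unity_sum n (Suc j))) = of_int c"
proof (rule prod_eval_roots_integer[OF half_poly_monic(2,1)])
  let ?w = "root_of_unity n" and ?N = "(n - 1) div 2"
  have small: "0 < Suc j + Suc k" "Suc j + Suc k < n" if "j < ?N" "k < ?N" for j k
    using that by linarith+
  note w0 = root_of_unity_nonzero[of n]
  show "inj_on (\<lambda>j. unity_sum n (Suc j)) {..<?N}"
  proof (rule inj_onI)
    fix j k assume jk: "j \<in> {..<?N}" "k \<in> {..<?N}" "unity_sum n (Suc j) = unity_sum n (Suc k)"
    let ?z = "?w ^ Suc j" and ?y = "?w ^ Suc k"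
    have "?z \<noteq> 0" "?y \<noteq> 0" using w0 by simp_all
    have id: "(a - b) * (a * b - 1) = a * b * ((a + inverse a) - (b + inverse b))"
      if "a \<noteq> 0" "b \<noteq> 0" for a b :: complex
      using that by (simp add: field_simps)
    have "?z + inverse ?z = ?y + inverse ?y" using jk(3) unfolding unity_sum_def .
    then have "(?z - ?y) * (?z * ?y - 1) = 0"
      unfolding id[OF \<open>?z \<noteq> 0\<close> \<open>?y \<noteq> 0\<close>] by simp
    moreover have "?z * ?y \<noteq> 1"
      using root_of_unity_power_eq_1[OF small, of j k] jk unfolding power_add by simp
    ultimately have "?z = ?y" by simp
    moreover have "Suc j < n" "Suc k < n" using jk by auto
    ultimately have "Suc j = Suc k"
      using inj_onD[OF root_of_unity_inj[of n], of "Suc j" "Suc k"] by blast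
    then show "j = k" by simp
  qed
  fix j assume j: "j < ?N"
  let ?z = "?w ^ Suc j"
  have "n > 0" using j by (cases n) auto
  have z0: "?z \<noteq> 0" using w0 by simp
  have "?z * ?z \<noteq> 1"
    using root_of_unity_power_eq_1[OF small[OF j j]] unfolding power_add .
  then have "?z \<noteq> inverse ?z" using z0 by (metis right_inverse)
  moreover have "?z ^ n = 1"
    using root_of_unity_power_n[OF \<open>n > 0\<close>] by (metis power_mult mult.commute power_one)
  moreover have "?z * inverse ?z = 1" using z0 by (rule right_inverse)
  ultimately show "eval_int (half_poly n) (unity_sum n (Suc j)) = 0"
    unfolding unity_sum_def using half_poly_root[of ?z n "inverse ?z"] \<open>n > 0\<close> by blast
qed

text \<open>Pair \<open>j\<close> with \<open>n - j\<close>; only \<open>n / 2\<close> is its own partner.\<close>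

lemma prod_symmetric:
  fixes f :: "nat \<Rightarrow> 'a::comm_monoid_mult"
  assumes n: "n > 0" and f: "\<And>j. 1 \<le> j \<Longrightarrow> j < n \<Longrightarrow> f (n - j) = f j"
  shows "(\<Prod>j = 1..<n. f j) =
    (\<Prod>j<(n - 1) div 2. f (Suc j)) ^ 2 * (if even n then f (n div 2) else 1)"
proof -
  let ?N = "(n - 1) div 2"
  let ?M = "if even n then {n div 2} else {}"
  have split: "{1..<n} = Suc ` {..<?N} \<union> ((\<lambda>j. n - Suc j) ` {..<?N} \<union> ?M)"
  proof (rule Set.set_eqI)
    fix x
    have "x \<in> Suc ` {..<?N} \<longleftrightarrow> 1 \<le> x \<and> x \<le> ?N"
      by (cases x) auto
    moreover have "x \<in> (\<lambda>j. n - Suc j) ` {..<?N} \<longleftrightarrow> n - ?N \<le> x \<and> x < n"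
    proof
      assume "n - ?N \<le> x \<and> x < n"
      then show "x \<in> (\<lambda>j. n - Suc j) ` {..<?N}"
        by (intro image_eqI[of _ _ "n - Suc x"]) auto
    qed auto
    moreover have "x \<in> ?M \<longleftrightarrow> ?N < x \<and> x < n - ?N"
      using n by (auto elim!: evenE oddE)
    ultimately show "x \<in> {1..<n} \<longleftrightarrow> x \<in> Suc ` {..<?N} \<union> ((\<lambda>j. n - Suc j) ` {..<?N} \<union> ?M)"
      by auto
  qed
  have "(\<Prod>j = 1..<n. f j) = prod f (Suc ` {..<?N}) * prod f ((\<lambda>j. n - Suc j) ` {..<?N} \<union> ?M)"
    unfolding split by (intro prod.union_disjoint) (auto elim!: evenE)
  also have "prod f ((\<lambda>j. n - Suc j) ` {..<?N} \<union> ?M) = prod f ((\<lambda>j. n - Suc j) ` {..<?N}) * prod f ?M"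
    by (intro prod.union_disjoint) (auto elim!: evenE)
  also have "prod f (Suc ` {..<?N}) = (\<Prod>j<?N. f (Suc j))"
    by (subst prod.reindex) simp_all
  also have "prod f ((\<lambda>j. n - Suc j) ` {..<?N}) = (\<Prod>j<?N. f (Suc j))"
    using f by (subst prod.reindex) (auto simp: inj_on_def intro!: prod.cong)
  finally show ?thesis by (simp add: power2_eq_square mult.assoc)
qed

lemma unity_sum_symmetric: "j < n \<Longrightarrow> unity_sum n (n - j) = unity_sum n j"
proof -
  assume j: "j < n"
  have "root_of_unity n ^ (n - j) * root_of_unity n ^ j = 1"
    using j root_of_unity_power_n[of n] by (simp flip: power_add)
  then have "root_of_unity n ^ (n - j) = inverse (root_of_unity n ^ j)"
    by (metis inverse_unique mult.commute)
  then show ?thesis unfolding unity_sum_def by simp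
qed

lemma unity_sum_half: "n > 0 \<Longrightarrow> even n \<Longrightarrow> unity_sum n (n div 2) = -2"
proof -
  assume n: "n > 0" "even n"
  then have "2 * pi * real (n div 2) / real n = pi" by (auto elim!: evenE)
  then show ?thesis unfolding unity_sum_def root_of_unity_power by simp
qed

text \<open>Each factor is \<open>(1 - w\<^sup>j) * (1 - w\<^sup>-\<^sup>j)\<close>, and the product of all \<open>X - w\<^sup>j\<close> with \<open>0 < j < n\<close> is
  \<open>1 + X + \<dots> + X\<^sup>n\<^sup>-\<^sup>1\<close>, which takes the value \<open>n\<close> at \<open>1\<close>.\<close>

lemma prod_two_minus_unity_sum:
  assumes n: "n > 0"
  shows "(\<Prod>j = 1..<n. 2 - unity_sum n j) = of_nat n ^ 2"
proof -
  let ?w = "root_of_unity n"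
  define A where "A = (\<lambda>j. ?w ^ j) ` {1..<n}"
  have inj: "inj_on (\<lambda>j. ?w ^ j) {1..<n}"
    using root_of_unity_inj[of n] by (rule inj_on_subset) auto
  define p where "p = (\<Prod>j = 1..<n. [:- (?w ^ j), 1:])"
  define q where "q = (\<Sum>k<n. monom (1::complex) k)"
  have deg: "degree p = n - 1" unfolding p_def by (subst degree_prod_eq_sum_degree) auto
  have "lead_coeff p = 1" unfolding p_def by (simp add: lead_coeff_prod)
  have coeff_q: "coeff q k = (if k < n then 1 else 0)" for k
    unfolding q_def by (simp add: coeff_sum)
  have "p = q"
  proof (rule poly_eqI_degree_lead_coeff[of _ "n - 1" _ A])
    show "coeff p (n - 1) = coeff q (n - 1)"
      using deg \<open>lead_coeff p = 1\<close> coeff_q n by simp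
    show "n - 1 \<le> card A" unfolding A_def card_image[OF inj] by simp
    show "degree p \<le> n - 1" using deg by simp
    show "degree q \<le> n - 1" by (rule degree_le) (use coeff_q in auto)
    fix z assume "z \<in> A"
    then obtain j where j: "1 \<le> j" "j < n" "z = ?w ^ j" unfolding A_def by auto
    have "poly p z = 0"
      unfolding p_def poly_prod using j by (intro prod_zero) (auto intro!: bexI[of _ j])
    moreover have "z \<noteq> 1" using root_of_unity_power_eq_1[of j n] j by simp
    moreover have "z ^ n = 1"
      unfolding j(3) using root_of_unity_power_n[OF n] by (metis power_mult mult.commute power_one)
    ultimately show "poly p z = poly q z"
      unfolding q_def by (simp add: poly_sum poly_monom geometric_sum)
  qed
  then have "poly p 1 = poly q 1" by simp
  then have 1: "(\<Prod>j = 1..<n. 1 - ?w ^ j) = of_nat n"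
    unfolding p_def q_def by (simp add: poly_prod poly_sum poly_monom)
  have "2 - unity_sum n j = (1 - ?w ^ j) * cnj (1 - ?w ^ j)" for j
  proof -
    have cnj: "?w ^ j * cnj (?w ^ j) = 1"
      using root_of_unity_cnj[of n] by (simp flip: power_mult_distrib add: mult.commute)
    then have "inverse (?w ^ j) = cnj (?w ^ j)" by (rule inverse_unique)
    then show ?thesis unfolding unity_sum_def using cnj by (simp add: algebra_simps)
  qed
  then have "(\<Prod>j = 1..<n. 2 - unity_sum n j) =
      (\<Prod>j = 1..<n. 1 - ?w ^ j) * cnj (\<Prod>j = 1..<n. 1 - ?w ^ j)"
    by (simp add: prod.distrib)
  then show ?thesis unfolding 1 by (simp add: power2_eq_square)
qed

section \<open>Counting spanning trees of a circulant foliation\<close>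

text \<open>The determinant of the Fourier block at \<open>z\<close> as a polynomial in \<open>z + z\<^sup>-\<^sup>1\<close>.  It is the associated
  polynomial at \<open>w = (z + z\<^sup>-\<^sup>1) / 2\<close>; in the new variable the root at \<open>2\<close> splits off with an
  integral cofactor.\<close>

definition foliation_poly :: "nat \<Rightarrow> (nat, 'e) multigraph \<Rightarrow> (nat \<Rightarrow> nat list) \<Rightarrow> int poly" where
  "foliation_poly m H s = det (mat m m (\<lambda>(i, l). [:laplacian H i l:] +
     (if i = l then \<Sum>x\<in>set (s i). [:2:] - power_sum_poly x else 0)))"

lemma of_int_laplacian: "of_int (laplacian G u w) = (laplacian G u w :: 'a::comm_ring_1)"
  unfolding laplacian_def by simp

lemma eval_foliation_poly:
  "eval_int (foliation_poly m H s) t = det (mat m m (\<lambda>(i, l). laplacian H i l +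
    of_bool (i = l) * (\<Sum>x\<in>set (s i). 2 - eval_int (power_sum_poly x) t)))"
  for t :: "'a::comm_ring_1"
  unfolding foliation_poly_def eval_int_hom.hom_det[symmetric]
  by (intro arg_cong[where f = det] eq_matI)
    (auto simp: of_int_laplacian eval_int_hom.hom_sum simp del: of_int_hom.hom_sum)

text \<open>The all-ones matrix is added to the Laplacian of the foliation.  Its Fourier transform
  has all entries \<open>n\<close> in the block of the trivial root of unity, so this block contributes the spanning
  trees of \<open>H\<close>; it vanishes in the other blocks, and these contribute values of \<open>foliation_poly\<close>.\<close>

lemma prod_unity_sums:
  assumes n: "n > 0" and H: "loopless_multigraph H" and verts: "verts H = {..<m}" and m: "m > 0"
    and s: "\<And>i x. i < m \<Longrightarrow> x \<in> set (s i) \<Longrightarrow> 1 \<le> x \<and> 2 * x \<le> n"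
  shows "of_nat n * of_nat (num_spanning_trees (circulant_foliation n H s)) =
    of_nat (num_spanning_trees H) * (\<Prod>j = 1..<n. eval_int (foliation_poly m H s) (unity_sum n j))"
proof -
  let ?G = "circulant_foliation n H s" and ?w = "root_of_unity n"
  let ?v = "\<lambda>a. (a div m, a mod m)"
  define S where "S j i l = laplacian H i l +
    of_bool (i = l) * (\<Sum>x\<in>set (s i). 2 - (?w ^ j) ^ x - inverse (?w ^ j) ^ x)" for j i l
  have "bij_betw ?v {..<n * m} ({..<n} \<times> {..<m})"
    using m by (intro bij_betwI[where g = "\<lambda>(k, i). k * m + i"])
      (auto simp: less_mult_imp_div_less intro: mult_add_less)
  then have v: "bij_betw ?v {..<n * m} (verts ?G)"
    using verts_foliation[OF H verts, of s n] s by simp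
  have loopless: "loopless_multigraph ?G"
    using H verts s by (rule loopless_foliation)
  have "det (mat (n * m) (n * m) (\<lambda>(a, b). laplacian ?G (?v a) (?v b) + 1)) =
      (\<Prod>j<n. det (mat m m (\<lambda>(i, l). S j i l + (if j = 0 then of_nat n else 0))))"
  proof (rule det_fourier_blocks[OF n])
    fix k i j l assume kijl: "k < n" "i < m" "j < n" "l < m"
    have "(?w ^ j) ^ n = 1"
      using root_of_unity_power_n[OF n] by (metis power_mult mult.commute power_one)
    then have lap: "(\<Sum>k'<n. laplacian ?G (k, i) (k', l) * (?w ^ j) ^ k') = (?w ^ j) ^ k * S j i l"
      unfolding S_def using s kijl by (intro foliation_laplacian_power[OF H verts]) auto
    have ones: "(\<Sum>k'<n. ?w ^ (k' * j)) = (if j = 0 then of_nat n else 0)"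
      using sum_root_of_unity[OF kijl(3), of 0] n by (simp add: mult.commute)
    have "(\<Sum>k'<n. (laplacian ?G (?v (k * m + i)) (?v (k' * m + l)) + 1) * ?w ^ (k' * j)) =
        (\<Sum>k'<n. laplacian ?G (k, i) (k', l) * (?w ^ j) ^ k') + (\<Sum>k'<n. ?w ^ (k' * j))"
      using kijl m by (simp add: algebra_simps sum.distrib flip: power_mult)
    also have "\<dots> = ?w ^ (k * j) * (S j i l + (if j = 0 then of_nat n else 0))"
      unfolding lap ones by (simp add: distrib_left mult.commute flip: power_mult)
    finally show "(\<Sum>k'<n. (laplacian ?G (?v (k * m + i)) (?v (k' * m + l)) + 1) * ?w ^ (k' * j)) =
        ?w ^ (k * j) * (S j i l + (if j = 0 then of_nat n else 0))" .
  qed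
  also have "\<dots> = (\<Prod>j\<in>insert 0 {1..<n}. det (mat m m (\<lambda>(i, l). S j i l + (if j = 0 then of_nat n else 0))))"
    using n by (intro prod.cong) auto
  also have "\<dots> = det (mat m m (\<lambda>(i, l). S 0 i l + of_nat n)) * (\<Prod>j = 1..<n. det (mat m m (\<lambda>(i, l). S j i l)))"
    by (subst prod.insert) (auto intro!: arg_cong2[where f = "(*)"] prod.cong)
  also have "det (mat m m (\<lambda>(i, l). S 0 i l + of_nat n)) =
      of_nat n * of_nat m ^ 2 * of_nat (num_spanning_trees H)"
    unfolding S_def using det_laplacian_add_constant[OF H _ m, of "\<lambda>i. i" "of_nat n"] verts
    by (simp add: bij_betw_def)
  also have "(\<Prod>j = 1..<n. det (mat m m (\<lambda>(i, l). S j i l))) =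
      (\<Prod>j = 1..<n. eval_int (foliation_poly m H s) (unity_sum n j))"
  proof (intro prod.cong refl)
    fix j
    have "?w ^ j * inverse (?w ^ j) = 1" using root_of_unity_nonzero[of n] by simp
    then show "det (mat m m (\<lambda>(i, l). S j i l)) = eval_int (foliation_poly m H s) (unity_sum n j)"
      unfolding eval_foliation_poly unity_sum_def S_def
      by (simp add: eval_power_sum_poly algebra_simps)
  qed
  finally have "of_nat (n * m) ^ 2 * of_nat (num_spanning_trees ?G) =
      of_nat n * of_nat m ^ 2 * of_nat (num_spanning_trees H) *
      (\<Prod>j = 1..<n. eval_int (foliation_poly m H s) (unity_sum n j))"
    using det_laplacian_add_constant[OF loopless v, where x = "1 :: complex"] n m by simp
  then have "(of_nat n * of_nat m ^ 2) * (of_nat n * of_nat (num_spanning_trees ?G)) =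
      (of_nat n * of_nat m ^ 2) * (of_nat (num_spanning_trees H) *
      (\<Prod>j = 1..<n. eval_int (foliation_poly m H s) (unity_sum n j)))"
    by (simp add: power2_eq_square mult_ac)
  then show ?thesis using n m by simp
qed

text \<open>At \<open>z = 1\<close> the jumps cancel, and what remains is the singular Laplacian of \<open>H\<close>.\<close>

lemma foliation_poly_at_2:
  assumes H: "loopless_multigraph H" and verts: "verts H = {..<m}" and m: "m > 0"
  shows "poly (foliation_poly m H s) 2 = 0"
proof -
  have "eval_int (power_sum_poly x) (1 + 1) = (1 ^ x + 1 ^ x :: complex)" for x
    by (rule eval_power_sum_poly) simp
  then have "eval_int (foliation_poly m H s) 2 = det (mat m m (\<lambda>(i, l). laplacian H i l :: complex))"
    unfolding eval_foliation_poly by simp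
  also have "\<dots> = 0"
    using det_laplacian_add_constant[OF H _ m, of "\<lambda>i. i" "0 :: complex"] verts
    by (simp add: bij_betw_def)
  finally show ?thesis using eval_int_of_int[of "foliation_poly m H s" 2, where 'a = complex] by simp
qed

lemma laplacian_eq_edge_count:
  assumes H: "loopless_multigraph H" and "u \<noteq> w"
  shows "laplacian H u w = (- of_nat (edge_count H u w) :: 'a::comm_ring_1)"
proof -
  have "{e \<in> incident H u. w \<in> ends H e} = {e \<in> edges H. ends H e = {u, w}}"
    using ends_other_end(1)[OF H] assms(2) unfolding incident_def by fastforce
  then show ?thesis
    using assms finite_incident[OF H, of u] unfolding laplacian_def edge_count_def
    by (simp add: sum_negf Int_def)
qed

lemma laplacian_diagonal:
  assumes H: "loopless_multigraph H" and u: "u \<in> verts H"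
  shows "laplacian H u u = (of_nat (degree_in H u) :: 'a::comm_ring_1)"
proof -
  have fin: "finite (verts H)" using H unfolding loopless_multigraph_def by simp
  have no_loop: "{e \<in> edges H. ends H e = {u, u}} = {}"
    using H unfolding loopless_multigraph_def by fastforce
  have uu: "edge_count H u u = 0" unfolding edge_count_def no_loop by simp
  have "laplacian H u u + (\<Sum>w\<in>verts H - {u}. laplacian H u w) = (0 :: 'a)"
    using laplacian_row_sum[OF H u, where 'a = 'a]
      sum.remove[OF fin u, of "laplacian H u :: _ \<Rightarrow> 'a"] by simp
  also have "(\<Sum>w\<in>verts H - {u}. laplacian H u w) =
      (- (\<Sum>w\<in>verts H - {u}. of_nat (edge_count H u w)) :: 'a)"
    unfolding sum_negf[symmetric] by (intro sum.cong refl laplacian_eq_edge_count[OF H]) auto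
  finally show ?thesis
    unfolding degree_in_def using sum.remove[OF fin u, of "edge_count H u"] uu by simp
qed

lemma chebyshev_T_at_minus_1: "poly (chebyshev_T k) (- 1) = (- 1) ^ k"
proof -
  have "of_int (poly (chebyshev_T k) (- 1)) = cos (real k * arccos (- 1))"
    using poly_chebyshev_T[of "-1" k] eval_int_of_int[of "chebyshev_T k" "-1", where 'a = real] by simp
  also have "\<dots> = of_int ((- 1) ^ k)" by simp
  finally show ?thesis unfolding of_int_eq_iff .
qed

lemma assoc_poly_at_minus_1:
  assumes H: "loopless_multigraph H" and verts: "verts H = {..<m}"
    and s: "\<And>i. i < m \<Longrightarrow> distinct (s i)"
  shows "poly (assoc_poly m H s) (- 1) = poly (foliation_poly m H s) (- 2)"
proof -
  have ev: "eval_int (chebyshev_T x) (- 1) = (of_int ((- 1) ^ x) :: complex)" for x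
    using eval_int_of_int[of "chebyshev_T x" "- 1", where 'a = complex] chebyshev_T_at_minus_1[of x] by simp
  have ev': "eval_int (power_sum_poly x) (- 2) = (2 * (- 1) ^ x :: complex)" for x
    using eval_power_sum_poly[of "- 1" "- 1 :: complex" x] by simp
  have weight: "eval_int (assoc_weight H s i) (- 1) =
      (of_nat (degree_in H i) + (\<Sum>x\<in>set (s i). 2 - 2 * (- 1) ^ x) :: complex)" if "i < m" for i
  proof -
    have "length (s i) = card (set (s i))" using distinct_card[OF s[OF that]] by simp
    then show ?thesis
      unfolding assoc_weight_def sum_list_distinct_conv_sum_set[OF s[OF that]]
      by (simp add: eval_int_hom.hom_sum eval_int_hom.hom_of_nat ev sum_subtractf sum_distrib_left
          del: of_int_hom.hom_sum)
  qed
  have "eval_int (assoc_poly m H s) (- 1) =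
      det (map_mat (\<lambda>p. eval_int p (- 1 :: complex))
        (mat_diag m (assoc_weight H s) - map_mat of_nat (adjacency_mat m H)))"
    unfolding assoc_poly_def by (rule eval_int_hom.hom_det[symmetric])
  also have "\<dots> = eval_int (foliation_poly m H s) (- 2)"
    unfolding eval_foliation_poly
  proof (intro arg_cong[where f = det] eq_matI)
    fix i l
    assume "i < dim_row (mat m m (\<lambda>(i, l). laplacian H i l +
          of_bool (i = l) * (\<Sum>x\<in>set (s i). 2 - eval_int (power_sum_poly x) (- 2 :: complex))))"
      "l < dim_col (mat m m (\<lambda>(i, l). laplacian H i l +
          of_bool (i = l) * (\<Sum>x\<in>set (s i). 2 - eval_int (power_sum_poly x) (- 2 :: complex))))"
    then have il: "i < m" "l < m" by simp_all
    have "edge_count H i i = 0"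
      using H unfolding edge_count_def loopless_multigraph_def by (fastforce simp: card_eq_0_iff)
    then show "map_mat (\<lambda>p. eval_int p (- 1 :: complex))
        (mat_diag m (assoc_weight H s) - map_mat of_nat (adjacency_mat m H)) $$ (i, l) =
      mat m m (\<lambda>(i, l). laplacian H i l +
        of_bool (i = l) * (\<Sum>x\<in>set (s i). 2 - eval_int (power_sum_poly x) (- 2 :: complex))) $$ (i, l)"
      using il weight[OF il(1)] laplacian_diagonal[OF H, of i, where 'a = complex] verts
        laplacian_eq_edge_count[OF H, of i l, where 'a = complex]
      by (cases "i = l") (simp_all add: adjacency_mat_def mat_diag_def ev' eval_int_hom.hom_of_nat)
  qed (simp_all add: adjacency_mat_def mat_diag_def)
  finally have "of_int (poly (assoc_poly m H s) (- 1)) =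
      (of_int (poly (foliation_poly m H s) (- 2)) :: complex)"
    using eval_int_of_int[of "assoc_poly m H s" "- 1", where 'a = complex]
      eval_int_of_int[of "foliation_poly m H s" "- 2", where 'a = complex] by simp
  then show ?thesis unfolding of_int_eq_iff .
qed

text \<open>The factors \<open>2 - t\<close> multiply to \<open>n\<^sup>2\<close>, which leaves one factor \<open>n\<close>.  The values of \<open>F\<close> pair up to a
  square, except for the value at \<open>t = -2\<close>, which belongs to the root of unity \<open>-1\<close> if \<open>n\<close> is even.\<close>

lemma num_spanning_trees_foliation:
  assumes n: "n > 0" and H: "loopless_multigraph H" and verts: "verts H = {..<m}" and m: "m > 0"
    and s: "\<And>i x. i < m \<Longrightarrow> x \<in> set (s i) \<Longrightarrow> 1 \<le> x \<and> 2 * x \<le> n"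
    and F: "foliation_poly m H s = [:2, -1:] * F"
  shows "\<exists>c::int. int (num_spanning_trees (circulant_foliation n H s)) =
    int n * int (num_spanning_trees H) * c\<^sup>2 * (if even n then poly F (- 2) else 1)"
proof -
  let ?f = "\<lambda>j. eval_int F (unity_sum n j)"
  obtain c :: int where c: "(\<Prod>j<(n - 1) div 2. ?f (Suc j)) = of_int c"
    using half_product_integer by metis
  have "(\<Prod>j = 1..<n. ?f j) = (of_int c)\<^sup>2 * (if even n then ?f (n div 2) else 1)"
    unfolding c[symmetric] using n by (rule prod_symmetric) (simp add: unity_sum_symmetric)
  also have "(if even n then ?f (n div 2) else 1) = of_int (if even n then poly F (- 2) else 1)"
    using unity_sum_half[OF n] eval_int_of_int[of F "- 2", where 'a = complex] by simp
  finally have prod: "(\<Prod>j = 1..<n. ?f j) = of_int (c\<^sup>2 * (if even n then poly F (- 2) else 1))"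
    by simp
  have "eval_int (foliation_poly m H s) t = (2 - t) * eval_int F t" for t :: complex
    unfolding F eval_int_simps(3) by simp
  then have "(\<Prod>j = 1..<n. eval_int (foliation_poly m H s) (unity_sum n j)) =
      of_nat n ^ 2 * of_int (c\<^sup>2 * (if even n then poly F (- 2) else 1))"
    using prod_two_minus_unity_sum[OF n] prod by (simp only: prod.distrib)
  then have "of_nat n * of_nat (num_spanning_trees (circulant_foliation n H s)) =
      (of_nat n * (of_nat n * of_nat (num_spanning_trees H) *
        of_int (c\<^sup>2 * (if even n then poly F (- 2) else 1))) :: complex)"
    using prod_unity_sums[OF n H verts m, of s] s by (simp add: power2_eq_square mult_ac)
  then have "(of_nat (num_spanning_trees (circulant_foliation n H s)) :: complex) =
      of_nat n * of_nat (num_spanning_trees H) *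
        of_int (c\<^sup>2 * (if even n then poly F (- 2) else 1))"
    using n by simp
  then have "of_int (int (num_spanning_trees (circulant_foliation n H s))) =
      (of_int (int n * int (num_spanning_trees H) * (c\<^sup>2 * (if even n then poly F (- 2) else 1))) :: complex)"
    by simp
  then show ?thesis unfolding of_int_eq_iff mult.assoc by blast
qed

text \<open>The factor \<open>4\<close> goes entirely into the square part.\<close>

lemma squarefree_part_of_four_mult:
  fixes q :: int
  shows "\<exists>r. q = squarefree_part (4 * q) * r\<^sup>2"
proof -
  have "2 dvd square_part (4 * q)"
    by (simp add: dvd_square_part_iff)
  then obtain r where r: "square_part (4 * q) = 2 * r" by blast
  have "4 * q = squarefree_part (4 * q) * (2 * r)\<^sup>2"
    using squarefree_decompose[of "4 * q"] unfolding r .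
  also have "\<dots> = 4 * (squarefree_part (4 * q) * r\<^sup>2)"
    by (simp add: power2_eq_square)
  finally show ?thesis by auto
qed

theorem theorem5p1:
  fixes H :: "(nat, 'e) multigraph" and m :: nat and s :: "nat \<Rightarrow> nat list" and p :: int
  assumes "loopless_multigraph H" and "connected_multigraph H" and "verts H = {..<m}"
    and "\<forall>i<m. jump_list (s i)"
    and "p = squarefree_part (poly (assoc_poly m H s) (-1))"
  shows "\<exists>a :: nat \<Rightarrow> int. \<forall>n\<ge>1. (\<forall>i<m. jumps_fit n (s i)) \<longrightarrow>
    (odd n \<longrightarrow> int (num_spanning_trees (circulant_foliation n H s)) =
        int n * int (num_spanning_trees H) * (a n)\<^sup>2) \<and>
    (even n \<longrightarrow> int (num_spanning_trees (circulant_foliation n H s)) =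
        p * int n * int (num_spanning_trees H) * (a n)\<^sup>2)"
proof -
  have m: "m > 0"
    using assms(2,3) unfolding connected_multigraph_def by auto
  have "[:- 2, 1:] dvd foliation_poly m H s"
    using foliation_poly_at_2[OF assms(1,3) m] by (simp add: poly_eq_0_iff_dvd)
  then obtain E where "foliation_poly m H s = [:- 2, 1:] * E" by blast
  then have F: "foliation_poly m H s = [:2, -1:] * (- E)" by simp
  define q where "q = poly (- E) (- 2)"
  have distinct: "distinct (s i)" if "i < m" for i
    using assms(4) that strict_sorted_iff unfolding jump_list_def by blast
  have "poly (assoc_poly m H s) (- 1) = 4 * q"
    using assoc_poly_at_minus_1[OF assms(1,3), of s] distinct unfolding F q_def by simp
  then obtain r where r: "q = p * r\<^sup>2"
    using squarefree_part_of_four_mult[of q] assms(5) by auto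
  have "\<exists>b. (odd n \<longrightarrow> int (num_spanning_trees (circulant_foliation n H s)) =
        int n * int (num_spanning_trees H) * b\<^sup>2) \<and>
    (even n \<longrightarrow> int (num_spanning_trees (circulant_foliation n H s)) =
        p * int n * int (num_spanning_trees H) * b\<^sup>2)"
    if n: "n \<ge> 1" and fit: "\<forall>i<m. jumps_fit n (s i)" for n
  proof -
    have "1 \<le> x \<and> 2 * x \<le> n" if "i < m" "x \<in> set (s i)" for i x
      using assms(4) fit that unfolding jump_list_def jumps_fit_def by blast
    moreover have "n > 0" using n by simp
    ultimately obtain c where c: "int (num_spanning_trees (circulant_foliation n H s)) =
        int n * int (num_spanning_trees H) * c\<^sup>2 * (if even n then poly (- E) (- 2) else 1)"
      using num_spanning_trees_foliation[OF _ assms(1,3) m _ F] by blast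
    show ?thesis
    proof (cases "even n")
      case True
      then show ?thesis
        using c unfolding q_def[symmetric] r
        by (intro exI[of _ "r * c"]) (simp add: power_mult_distrib mult_ac)
    next
      case False
      then show ?thesis using c by auto
    qed
  qed
  then show ?thesis by metis
qed

end
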